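(* Fix a prediction horizon $N\ge 1$ and a Bernstein degree $q\ge 1$. Let $w=(x_0,u_0,\dots,u_{N-1})\in\mathbb{R}^{n+mN}$, let $y_0(w)=(x_0,u_0)$, and for $l=1,\dots,N-1$ let $y_l(w)=(z_{l-1},\Delta u_l)$ with $z_{l-1}=(x_0,u_0,\dots,u_{l-1})$ and $\Delta u_l=u_l-u_{l-1}$. Let $\mathcal{I}=\{0,\dots,N-1\}\times\{1,\dots,n_c\}$, and with $M_{l,i}$ and $B_{l,i,N_s,q}$ as defined in the context, define $$\mathcal{F}=\{w: M_{l,i}(y_l(w))\le b_i\ \ \forall (l,i)\in\mathcal{I}\},\qquad \mathcal{F}_{N_s}=\{w: B_{l,i,N_s,q}(y_l(w))\le b_i\ \ \forall (l,i)\in\mathcal{I}\}.$$ Suppose that for all $l=1,\dots,N-1$ and $i=1,\dots,n_c$ the function $\hat\psi^{\rm ns}_{l,i}$ is $L^{\rm ns}_{l,i}$-smooth, $\psi^{\rm sm}_{l,i}$ is $L^{\rm sm}_{l,i}$-smooth, and $\psi^{\rm sm}_{l,i}$ has Lipschitz constant $K^{\rm sm}_{l,i}$ on $[0,1]$; and that for all $i=1,\dots,n_c$ the function $\hat\psi_{0,i}$ is $L_{0,i}$-smooth. Assume also that there is a point $\bar w$ with $M_{l,i}(y_l(\bar w))<b_i$ for all $(l,i)\in\mathcal{I}$. Then $$\lim_{N_s\to\infty}\mathcal{F}_{N_s}=\mathcal{F}$$ in the Painlevé–Kuratowski sense.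
   Context: Data: $\alpha\in(0,1]$, $h>0$, $A\in\mathbb{R}^{n\times n}$, $B\in\mathbb{R}^{n\times m}$, $H\in\mathbb{R}^{n_c\times n}$ with $i$-th row $H_i$, $b\in\mathbb{R}^{n_c}$, with $\{x\in\mathbb{R}^n:Hx\le b\}$ nonempty. Mittag-Leffler functions: for a square matrix $Z$, $E_{\alpha,\beta}(Z)=\sum_{j=0}^\infty \frac{Z^j}{\Gamma(\alpha j+\beta)}$ and $E_\alpha=E_{\alpha,1}$. Write $(a)_+=\max\{0,a\}$. For $\rho\ge 0$ let $G(\rho)=\rho E_{\alpha,\alpha+1}(A\rho)$, and for $t\ge0$ let $\mu(t)=E_\alpha(At^\alpha)$ and $\sigma_k(t)=G((t-kh)_+^\alpha)-G((t-(k+1)h)_+^\alpha)$ for $k=0,1,\ldots$ (These describe the response $x(t)=\mu(t)x_0+\sum_{k=0}^{\lfloor t/h\rfloor}\sigma_k(t)Bu_k$ of the Caputo fractional system $\mathrm{D}^\alpha x=Ax+Bu$ with zero-order-hold input $u(t)=u_k$ on $[kh,(k+1)h)$; $M_{l,i}$ below is the supremum of $H_ix(t)$ over $t\in[lh,(l+1)h]$.) For $l\ge 1$ let $d_l=n+ml$ and for $\tau\in[0,1]$, with $t=h(l+\tau)$, define the $n\times d_l$ matrix $$S_l(\tau)=\big[\mu(t)\;\;\sigma_0(t)B\;\;\cdots\;\;\sigma_{l-2}(t)B\;\;G(h^\alpha(1+\tau)^\alpha)B\big]$$ (for $l=1$ there are no $\sigma$ blocks), and $$\psi^{\rm sm}_{l,i}(\tau)=(H_iS_l(\tau))^\top,\qquad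 \psi^{\rm ns}_{l,i}(\tau)=(H_iG(h^\alpha\tau^\alpha)B)^\top,\qquad \hat\psi^{\rm ns}_{l,i}(\rho)=(H_iG(h^\alpha\rho)B)^\top\ (\rho\in[0,1]).$$ For $l=0$ define, for $\rho\in[0,1]$, $\hat\psi_{0,i}(\rho)=[H_iE_\alpha(Ah^\alpha\rho)\;\;H_iG(h^\alpha\rho)B]^\top\in\mathbb{R}^{n+m}$. Norms: fix norms $\|\cdot\|$ on the spaces $\mathbb{R}^{d_l}$, $\mathbb{R}^m$, $\mathbb{R}^{n+m}$; all Lipschitz and smoothness constants refer to them, and $\|\cdot\|_*$ denotes the corresponding dual norm. A function $f:[0,1]\to X$ into a normed space is $L$-smooth if it is differentiable (one-sidedly at endpoints) and $\|f'(x)-f'(y)\|\le L|x-y|$ for all $x,y\in[0,1]$. Exact functions: for $l\ge1$ and $y_l=(z_{l-1},\Delta u_l)$, $M_{l,i}(y_l)=\sup_{\tau\in[0,1]}\{\psi^{\rm sm}_{l,i}(\tau)^\top z_{l-1}+\psi^{\rm ns}_{l,i}(\tau)^\top\Delta u_l\}$; for $l=0$, $M_{0,i}(y_0)=\sup_{\rho\in[0,1]}\hat\psi_{0,i}(\rho)^\top y_0$. Approximate functions, $l\ge1$: for $r=0,\dots,N_s-1$ let $\rho_r=(r/N_s)^\alpha$, and for $\nu=0,\dots,q$ let $$s^\nu_{l,i,r}=\psi^{\rm sm}_{l,i}\!\left(\tfrac{r+\nu/q}{N_s}\right),\qquad n^\nu_{l,i,r}=\hat\psi^{\rm ns}_{l,i}\!\left(\rho_r+\tfrac{\nu}{q}(\rho_{r+1}-\rho_r)\right).$$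 Let $\eta^{\rm sm}_{l,i,r}=\frac{L^{\rm sm}_{l,i,r}}{8q}$ and $\eta^{\rm ns}_{l,i,r}=\frac{L^{\rm ns}_{l,i,r}}{8q}$, where $L^{\rm sm}_{l,i,r}$ and $L^{\rm ns}_{l,i,r}$ are smoothness constants on $[0,1]$ of the normalized local maps $\tau\mapsto\psi^{\rm sm}_{l,i}((r+\tau)/N_s)$ and $\theta\mapsto\hat\psi^{\rm ns}_{l,i}(\rho_r+\theta(\rho_{r+1}-\rho_r))$, respectively, chosen no larger than the constants inherited by scaling: $L^{\rm sm}_{l,i,r}\le L^{\rm sm}_{l,i}/N_s^2$ and $L^{\rm ns}_{l,i,r}\le L^{\rm ns}_{l,i}(\rho_{r+1}-\rho_r)^2$. Define $$B_{l,i,r,N_s,q}(y_l)=\max_{\nu=0,\dots,q}(s^\nu_{l,i,r})^\top z_{l-1}+\eta^{\rm sm}_{l,i,r}\|z_{l-1}\|_*+\max_{\nu=0,\dots,q}(n^\nu_{l,i,r})^\top\Delta u_l+\eta^{\rm ns}_{l,i,r}\|\Delta u_l\|_*$$ and $B_{l,i,N_s,q}(y_l)=\max_{r=0,\dots,N_s-1}B_{l,i,r,N_s,q}(y_l)$. Approximate functions, $l=0$ (uniform partition in the variable $\rho$): let $p^\nu_{0,i,r}=\hat\psi_{0,i}((r+\nu/q)/N_s)$ and $\eta_{0,i,r}=\frac{L_{0,i,r}}{8q}$, where $L_{0,i,r}\le L_{0,i}/N_s^2$ is a smoothness constant on $[0,1]$ of $\theta\mapsto\hat\psi_{0,i}((r+\theta)/N_s)$.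 Define $B_{0,i,r}(y_0)=\max_{\nu=0,\dots,q}(p^\nu_{0,i,r})^\top y_0+\eta_{0,i,r}\|y_0\|_*$ and $B_{0,i,N_s,q}(y_0)=\max_{r=0,\dots,N_s-1}B_{0,i,r}(y_0)$. Painlevé–Kuratowski convergence $\lim_k C_k=C$ means $\limsup_k C_k=\liminf_k C_k=C$, where $\limsup_k C_k$ is the set of limits of sequences $\zeta_k\in C_k$ taken along some infinite set of indices $k$, and $\liminf_k C_k$ is the set of limits of sequences with $\zeta_k\in C_k$ for all sufficiently large $k$. *)

theory Defs
  imports "HOL-Analysis.Analysis" "HOL-Analysis.Finite_Function_Topology"
begin

section \<open>Mittag-Leffler functions and the sampled-data response\<close>

text \<open>On type \<^typ>\<open>real^'n^'n\<close> the library's multiplication is componentwise, so the power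
  operator is not the matrix power.\<close>

primrec matpow :: "real^'n^'n \<Rightarrow> nat \<Rightarrow> real^'n^'n" where
  "matpow Z 0 = mat 1"
| "matpow Z (Suc j) = Z ** matpow Z j"

definition mittag_leffler :: "real \<Rightarrow> real \<Rightarrow> real^'n^'n \<Rightarrow> real^'n^'n" where
  "mittag_leffler \<alpha> \<beta> Z = suminf (\<lambda>j. (1 / Gamma (\<alpha> * real j + \<beta>)) *\<^sub>R matpow Z j)"

definition Gfun :: "real \<Rightarrow> real^'n^'n \<Rightarrow> real \<Rightarrow> real^'n^'n" where
  "Gfun \<alpha> A \<rho> = \<rho> *\<^sub>R mittag_leffler \<alpha> (\<alpha> + 1) (\<rho> *\<^sub>R A)"

definition mu :: "real \<Rightarrow> real^'n^'n \<Rightarrow> real \<Rightarrow> real^'n^'n" where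
  "mu \<alpha> A t = mittag_leffler \<alpha> 1 ((t powr \<alpha>) *\<^sub>R A)"

text \<open>For \<open>\<alpha> > 0\<close> the library convention \<^term>\<open>0 powr \<alpha> = (0::real)\<close> agrees with \<open>0\<^sup>\<alpha> = 0\<close>.\<close>

definition sigma :: "real \<Rightarrow> real \<Rightarrow> real^'n^'n \<Rightarrow> nat \<Rightarrow> real \<Rightarrow> real^'n^'n" where
  "sigma \<alpha> h A k t =
     Gfun \<alpha> A (max 0 (t - real k * h) powr \<alpha>) - Gfun \<alpha> A (max 0 (t - real (Suc k) * h) powr \<alpha>)"


section \<open>Stacked vectors\<close>

text \<open>A vector \<open>(x, u\<^sub>0, \<dots>, u\<^bsub>l-1\<^esub>)\<close> of \<open>\<real>\<^bsup>n+ml\<^esup>\<close> is a pair of \<open>x\<close> and a finitely supported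
  sequence of blocks that vanishes from index \<open>l\<close> on.  For varying \<open>l\<close> these spaces are
  finite-dimensional subspaces of a single normed space, whose norm induces on each of them the
  Euclidean topology.\<close>

type_synonym ('n, 'm) stack = "(real^'n) \<times> (nat \<Rightarrow>\<^sub>0 real^'m)"

definition stack_space :: "nat \<Rightarrow> ('n::finite, 'm::finite) stack set" where
  "stack_space l = {z. Poly_Mapping.keys (snd z) \<subseteq> {..<l}}"

definition blocks :: "nat \<Rightarrow> (nat \<Rightarrow> real^'m) \<Rightarrow> (nat \<Rightarrow>\<^sub>0 real^'m)" where
  "blocks l f = (\<Sum>k<l. Poly_Mapping.single k (f k))"

lemma lookup_blocks: "Poly_Mapping.lookup (blocks l f) k = (if k < l then f k else 0)"
  by (simp add: blocks_def lookup_sum lookup_single when_def sum.delta)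

definition stack_inner :: "('n::finite, 'm::finite) stack \<Rightarrow> ('n, 'm) stack \<Rightarrow> real" where
  "stack_inner v z = fst v \<bullet> fst z +
     (\<Sum>k\<in>Poly_Mapping.keys (snd v). Poly_Mapping.lookup (snd v) k \<bullet> Poly_Mapping.lookup (snd z) k)"


section \<open>Norms, dual norms and smoothness\<close>

definition norm_on :: "'a::real_vector set \<Rightarrow> ('a \<Rightarrow> real) \<Rightarrow> bool" where
  "norm_on V nrm \<longleftrightarrow>
     (\<forall>x\<in>V. 0 \<le> nrm x \<and> (nrm x = 0 \<longleftrightarrow> x = 0)) \<and>
     (\<forall>c. \<forall>x\<in>V. nrm (c *\<^sub>R x) = \<bar>c\<bar> * nrm x) \<and>
     (\<forall>x\<in>V. \<forall>y\<in>V. nrm (x + y) \<le> nrm x + nrm y)"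

definition dual_norm :: "('a \<Rightarrow> 'a \<Rightarrow> real) \<Rightarrow> 'a set \<Rightarrow> ('a \<Rightarrow> real) \<Rightarrow> 'a \<Rightarrow> real" where
  "dual_norm ip V nrm y = (SUP v\<in>{v\<in>V. nrm v \<le> 1}. ip v y)"

text \<open>The map takes values in a finite-dimensional space, where all norms are equivalent; hence
  differentiability does not depend on the norm \<open>nrm\<close>, and only the constant does.\<close>

definition smooth_unit :: "('a::real_normed_vector \<Rightarrow> real) \<Rightarrow> real \<Rightarrow> (real \<Rightarrow> 'a) \<Rightarrow> bool" where
  "smooth_unit nrm L f \<longleftrightarrow>
     (\<exists>f'. (\<forall>x\<in>{0..1}. (f has_vector_derivative f' x) (at x within {0..1})) \<and>
           (\<forall>x\<in>{0..1}. \<forall>y\<in>{0..1}. nrm (f' x - f' y) \<le> L * \<bar>x - y\<bar>))"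

definition lipschitz_unit :: "('a::real_vector \<Rightarrow> real) \<Rightarrow> real \<Rightarrow> (real \<Rightarrow> 'a) \<Rightarrow> bool" where
  "lipschitz_unit nrm K f \<longleftrightarrow> (\<forall>x\<in>{0..1}. \<forall>y\<in>{0..1}. nrm (f x - f y) \<le> K * \<bar>x - y\<bar>)"


section \<open>Constraint functions\<close>

text \<open>Block \<open>k < l\<close> of the input part of the matrix \<open>S\<^sub>l(\<tau>)\<close>; its first block is \<open>\<mu>(h(l + \<tau>))\<close>.\<close>

definition S_input ::
  "real \<Rightarrow> real \<Rightarrow> real^'n^'n \<Rightarrow> real^'m^'n \<Rightarrow> nat \<Rightarrow> real \<Rightarrow> nat \<Rightarrow> real^'m^'n" where
  "S_input \<alpha> h A B l \<tau> k =
     (if Suc k < l then sigma \<alpha> h A k (h * (real l + \<tau>)) ** B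
      else Gfun \<alpha> A (h powr \<alpha> * (1 + \<tau>) powr \<alpha>) ** B)"

definition psi_sm ::
  "real \<Rightarrow> real \<Rightarrow> real^'n^'n \<Rightarrow> real^'m^'n \<Rightarrow> real^'n^'c \<Rightarrow> nat \<Rightarrow> 'c \<Rightarrow> real \<Rightarrow> ('n, 'm) stack" where
  "psi_sm \<alpha> h A B H l i \<tau> =
     ((H $ i) v* mu \<alpha> A (h * (real l + \<tau>)), blocks l (\<lambda>k. (H $ i) v* S_input \<alpha> h A B l \<tau> k))"

text \<open>\<open>\<psi>\<^sup>n\<^sup>s\<^bsub>l,i\<^esub>\<close> and its reparametrization do not depend on \<open>l\<close>.\<close>

definition psi_ns ::
  "real \<Rightarrow> real \<Rightarrow> real^'n^'n \<Rightarrow> real^'m^'n \<Rightarrow> real^'n^'c \<Rightarrow> 'c \<Rightarrow> real \<Rightarrow> real^'m" where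
  "psi_ns \<alpha> h A B H i \<tau> = (H $ i) v* (Gfun \<alpha> A (h powr \<alpha> * \<tau> powr \<alpha>) ** B)"

definition psi_ns_hat ::
  "real \<Rightarrow> real \<Rightarrow> real^'n^'n \<Rightarrow> real^'m^'n \<Rightarrow> real^'n^'c \<Rightarrow> 'c \<Rightarrow> real \<Rightarrow> real^'m" where
  "psi_ns_hat \<alpha> h A B H i \<rho> = (H $ i) v* (Gfun \<alpha> A (h powr \<alpha> * \<rho>) ** B)"

definition psi_zero_hat ::
  "real \<Rightarrow> real \<Rightarrow> real^'n^'n \<Rightarrow> real^'m^'n \<Rightarrow> real^'n^'c \<Rightarrow> 'c \<Rightarrow> real \<Rightarrow> (real^'n) \<times> (real^'m)" where
  "psi_zero_hat \<alpha> h A B H i \<rho> =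
     ((H $ i) v* mittag_leffler \<alpha> 1 ((h powr \<alpha> * \<rho>) *\<^sub>R A),
      (H $ i) v* (Gfun \<alpha> A (h powr \<alpha> * \<rho>) ** B))"

definition M_pos ::
  "real \<Rightarrow> real \<Rightarrow> real^'n^'n \<Rightarrow> real^'m^'n \<Rightarrow> real^'n^'c \<Rightarrow> nat \<Rightarrow> 'c
     \<Rightarrow> ('n, 'm) stack \<times> (real^'m) \<Rightarrow> real" where
  "M_pos \<alpha> h A B H l i y =
     (SUP \<tau>\<in>{0..1}. stack_inner (psi_sm \<alpha> h A B H l i \<tau>) (fst y) + psi_ns \<alpha> h A B H i \<tau> \<bullet> snd y)"

definition M_zero ::
  "real \<Rightarrow> real \<Rightarrow> real^'n^'n \<Rightarrow> real^'m^'n \<Rightarrow> real^'n^'c \<Rightarrow> 'c \<Rightarrow> (real^'n) \<times> (real^'m) \<Rightarrow> real" where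
  "M_zero \<alpha> h A B H i y = (SUP \<rho>\<in>{0..1}. psi_zero_hat \<alpha> h A B H i \<rho> \<bullet> y)"


section \<open>Piecewise upper bounds\<close>

definition grid :: "real \<Rightarrow> nat \<Rightarrow> nat \<Rightarrow> real" where
  "grid \<alpha> Ns r = (real r / real Ns) powr \<alpha>"

definition local_sm ::
  "real \<Rightarrow> real \<Rightarrow> real^'n^'n \<Rightarrow> real^'m^'n \<Rightarrow> real^'n^'c \<Rightarrow> nat \<Rightarrow> nat \<Rightarrow> 'c \<Rightarrow> nat
     \<Rightarrow> real \<Rightarrow> ('n, 'm) stack" where
  "local_sm \<alpha> h A B H Ns l i r \<tau> = psi_sm \<alpha> h A B H l i ((real r + \<tau>) / real Ns)"

definition local_ns ::
  "real \<Rightarrow> real \<Rightarrow> real^'n^'n \<Rightarrow> real^'m^'n \<Rightarrow> real^'n^'c \<Rightarrow> nat \<Rightarrow> 'c \<Rightarrow> nat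
     \<Rightarrow> real \<Rightarrow> real^'m" where
  "local_ns \<alpha> h A B H Ns i r \<theta> =
     psi_ns_hat \<alpha> h A B H i (grid \<alpha> Ns r + \<theta> * (grid \<alpha> Ns (Suc r) - grid \<alpha> Ns r))"

definition local_zero ::
  "real \<Rightarrow> real \<Rightarrow> real^'n^'n \<Rightarrow> real^'m^'n \<Rightarrow> real^'n^'c \<Rightarrow> nat \<Rightarrow> 'c \<Rightarrow> nat
     \<Rightarrow> real \<Rightarrow> (real^'n) \<times> (real^'m)" where
  "local_zero \<alpha> h A B H Ns i r \<theta> = psi_zero_hat \<alpha> h A B H i ((real r + \<theta>) / real Ns)"

text \<open>The arguments \<open>nz\<close>, \<open>nu\<close>, \<open>n0\<close> are the norms on \<open>\<real>\<^bsup>n+ml\<^esup>\<close>, \<open>\<real>\<^sup>m\<close>, \<open>\<real>\<^bsup>n+m\<^esup>\<close>; \<open>Lsm r\<close>, \<open>Lns r\<close>,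
  \<open>L0 r\<close> are the smoothness constants of the local maps on the \<open>r\<close>-th piece.\<close>

definition B_pos_piece ::
  "real \<Rightarrow> real \<Rightarrow> real^'n^'n \<Rightarrow> real^'m^'n \<Rightarrow> real^'n^'c
     \<Rightarrow> (('n, 'm) stack \<Rightarrow> real) \<Rightarrow> (real^'m \<Rightarrow> real) \<Rightarrow> (nat \<Rightarrow> real) \<Rightarrow> (nat \<Rightarrow> real)
     \<Rightarrow> nat \<Rightarrow> nat \<Rightarrow> nat \<Rightarrow> 'c \<Rightarrow> nat \<Rightarrow> ('n, 'm) stack \<times> (real^'m) \<Rightarrow> real" where
  "B_pos_piece \<alpha> h A B H nz nu Lsm Lns q Ns l i r y =
     (MAX \<nu>\<in>{0..q}. stack_inner (local_sm \<alpha> h A B H Ns l i r (real \<nu> / real q)) (fst y))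
     + Lsm r / (8 * real q) * dual_norm stack_inner (stack_space l) nz (fst y)
     + (MAX \<nu>\<in>{0..q}. local_ns \<alpha> h A B H Ns i r (real \<nu> / real q) \<bullet> snd y)
     + Lns r / (8 * real q) * dual_norm (\<bullet>) UNIV nu (snd y)"

definition B_pos ::
  "real \<Rightarrow> real \<Rightarrow> real^'n^'n \<Rightarrow> real^'m^'n \<Rightarrow> real^'n^'c
     \<Rightarrow> (('n, 'm) stack \<Rightarrow> real) \<Rightarrow> (real^'m \<Rightarrow> real) \<Rightarrow> (nat \<Rightarrow> real) \<Rightarrow> (nat \<Rightarrow> real)
     \<Rightarrow> nat \<Rightarrow> nat \<Rightarrow> nat \<Rightarrow> 'c \<Rightarrow> ('n, 'm) stack \<times> (real^'m) \<Rightarrow> real" where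
  "B_pos \<alpha> h A B H nz nu Lsm Lns q Ns l i y =
     (MAX r\<in>{0..<Ns}. B_pos_piece \<alpha> h A B H nz nu Lsm Lns q Ns l i r y)"

definition B_zero_piece ::
  "real \<Rightarrow> real \<Rightarrow> real^'n^'n \<Rightarrow> real^'m^'n \<Rightarrow> real^'n^'c
     \<Rightarrow> ((real^'n) \<times> (real^'m) \<Rightarrow> real) \<Rightarrow> (nat \<Rightarrow> real)
     \<Rightarrow> nat \<Rightarrow> nat \<Rightarrow> 'c \<Rightarrow> nat \<Rightarrow> (real^'n) \<times> (real^'m) \<Rightarrow> real" where
  "B_zero_piece \<alpha> h A B H n0 L0 q Ns i r y =
     (MAX \<nu>\<in>{0..q}. local_zero \<alpha> h A B H Ns i r (real \<nu> / real q) \<bullet> y)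
     + L0 r / (8 * real q) * dual_norm (\<bullet>) UNIV n0 y"

definition B_zero ::
  "real \<Rightarrow> real \<Rightarrow> real^'n^'n \<Rightarrow> real^'m^'n \<Rightarrow> real^'n^'c
     \<Rightarrow> ((real^'n) \<times> (real^'m) \<Rightarrow> real) \<Rightarrow> (nat \<Rightarrow> real)
     \<Rightarrow> nat \<Rightarrow> nat \<Rightarrow> 'c \<Rightarrow> (real^'n) \<times> (real^'m) \<Rightarrow> real" where
  "B_zero \<alpha> h A B H n0 L0 q Ns i y =
     (MAX r\<in>{0..<Ns}. B_zero_piece \<alpha> h A B H n0 L0 q Ns i r y)"


section \<open>Feasible sets and set convergence\<close>

definition y_zero :: "('n::finite, 'm::finite) stack \<Rightarrow> (real^'n) \<times> (real^'m)" where
  "y_zero w = (fst w, Poly_Mapping.lookup (snd w) 0)"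

definition y_pos :: "nat \<Rightarrow> ('n::finite, 'm::finite) stack \<Rightarrow> ('n, 'm) stack \<times> (real^'m)" where
  "y_pos l w =
     ((fst w, blocks l (Poly_Mapping.lookup (snd w))),
      Poly_Mapping.lookup (snd w) l - Poly_Mapping.lookup (snd w) (l - 1))"

definition feasible ::
  "real \<Rightarrow> real \<Rightarrow> real^'n^'n \<Rightarrow> real^'m^'n \<Rightarrow> real^'n^'c \<Rightarrow> real^'c \<Rightarrow> nat \<Rightarrow> ('n, 'm) stack set" where
  "feasible \<alpha> h A B H b N =
     {w \<in> stack_space N.
        (\<forall>i. M_zero \<alpha> h A B H i (y_zero w) \<le> b $ i) \<and>
        (\<forall>l\<in>{1..<N}. \<forall>i. M_pos \<alpha> h A B H l i (y_pos l w) \<le> b $ i)}"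

definition feasible_approx ::
  "real \<Rightarrow> real \<Rightarrow> real^'n^'n \<Rightarrow> real^'m^'n \<Rightarrow> real^'n^'c \<Rightarrow> real^'c \<Rightarrow> nat
     \<Rightarrow> (nat \<Rightarrow> ('n, 'm) stack \<Rightarrow> real) \<Rightarrow> (real^'m \<Rightarrow> real) \<Rightarrow> ((real^'n) \<times> (real^'m) \<Rightarrow> real)
     \<Rightarrow> (nat \<Rightarrow> nat \<Rightarrow> 'c \<Rightarrow> nat \<Rightarrow> real) \<Rightarrow> (nat \<Rightarrow> nat \<Rightarrow> 'c \<Rightarrow> nat \<Rightarrow> real) \<Rightarrow> (nat \<Rightarrow> 'c \<Rightarrow> nat \<Rightarrow> real)
     \<Rightarrow> nat \<Rightarrow> nat \<Rightarrow> ('n, 'm) stack set" where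
  "feasible_approx \<alpha> h A B H b N nz nu n0 Lsm Lns L0 q Ns =
     {w \<in> stack_space N.
        (\<forall>i. B_zero \<alpha> h A B H n0 (L0 Ns i) q Ns i (y_zero w) \<le> b $ i) \<and>
        (\<forall>l\<in>{1..<N}. \<forall>i.
           B_pos \<alpha> h A B H (nz l) nu (Lsm Ns l i) (Lns Ns l i) q Ns l i (y_pos l w) \<le> b $ i)}"

definition PK_limsup :: "(nat \<Rightarrow> 'a::topological_space set) \<Rightarrow> 'a set" where
  "PK_limsup C = {x. \<exists>\<kappa> \<zeta>. strict_mono \<kappa> \<and> (\<forall>j. \<zeta> j \<in> C (\<kappa> j)) \<and> \<zeta> \<longlonglongrightarrow> x}"

definition PK_liminf :: "(nat \<Rightarrow> 'a::topological_space set) \<Rightarrow> 'a set" where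
  "PK_liminf C = {x. \<exists>\<zeta>. (\<forall>\<^sub>F k in sequentially. \<zeta> k \<in> C k) \<and> \<zeta> \<longlonglongrightarrow> x}"

definition PK_converges :: "(nat \<Rightarrow> 'a::topological_space set) \<Rightarrow> 'a set \<Rightarrow> bool" where
  "PK_converges C D \<longleftrightarrow> PK_limsup C = D \<and> PK_liminf C = D"

end

theory Submission
  imports Defs
begin

text \<open>
  The exact feasible set is described by finitely many constraints \<open>M w \<le> b\<close>, where each \<open>M\<close> is a
  supremum, over a compact interval, of continuous linear functions of \<open>w\<close>.  It is thus closed and
  convex, and the approximate sets replace each \<open>M\<close> by some \<open>B\<close> that depends on the number
  \<open>N\<^sub>s\<close> of pieces.  Convergence rests on two properties of these functions.

  First, \<open>M \<le> B\<close> as soon as there is a piece (\<open>M_zero_le_B_zero\<close>, \<open>M_pos_le_B_pos\<close>): on each piece,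
  a function with \<open>L\<close>-Lipschitz derivative exceeds its largest value at the nodes \<open>\<nu>/q\<close> by at most
  \<open>L/(8q)\<close> (\<open>ip_le_Max_nodes\<close>).  So the approximate sets are contained in the closed
  exact one, and so is their outer limit.

  Second, \<open>B\<close> is at most \<open>M\<close> plus an error that vanishes pointwise as \<open>N\<^sub>s \<rightarrow> \<infinity>\<close>
  (\<open>B_zero_le\<close>, \<open>B_pos_le\<close>).  The scaled smoothness constants contribute terms of order \<open>N\<^sub>s\<^bsup>-2\<^esup>\<close> and
  \<open>N\<^sub>s\<^bsup>-2\<alpha>\<^esup>\<close>; taking the maxima of the smooth and the nonsmooth part separately costs a Lipschitz term of
  order \<open>1/N\<^sub>s\<close>, since both maxima refer to times in the same cell.  So a point
  that satisfies a constraint strictly satisfies its approximation for large \<open>N\<^sub>s\<close>.  Points on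
  the segment from a feasible point to the Slater point satisfy all constraints strictly by
  convexity, which gives the inner limit.

  Both properties are combined in \<open>PK_converges_inner_approximation\<close>.  The Mittag-Leffler functions enter
  through the smoothness of the constraint curves.
  The norms are arbitrary, so finiteness of the dual norms comes from the equivalence of norms on
  the finite-dimensional spaces of stacks (\<open>normed_pairing_stack\<close>).
\<close>


section \<open>Inner approximation of convex feasible sets\<close>

text \<open>A selection with \<open>dist (\<zeta> k) x\<close> within \<open>1/(k+1)\<close> of the infimal distance to \<open>C k\<close> converges, because
  these infimal distances tend to \<open>0\<close>; this replaces a diagonal argument.\<close>

lemma PK_liminfI_metric:
  fixes x :: "'a::metric_space"
  assumes near: "\<And>e. 0 < e \<Longrightarrow> \<forall>\<^sub>F k in sequentially. \<exists>y\<in>C k. dist y x < e"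
  shows "x \<in> PK_liminf C"
proof -
  define \<zeta> where
    "\<zeta> k = (SOME y. y \<in> C k \<and> dist y x \<le> infdist x (C k) + inverse (real (Suc k)))" for k
  have nonempty: "\<forall>\<^sub>F k in sequentially. C k \<noteq> {}"
    using near[of 1] by (auto elim: eventually_mono)
  have pick: "\<zeta> k \<in> C k \<and> dist (\<zeta> k) x \<le> infdist x (C k) + inverse (real (Suc k))"
    if "C k \<noteq> {}" for k
  proof -
    have "(INF y\<in>C k. dist x y) < infdist x (C k) + inverse (real (Suc k))"
      using that by (simp add: infdist_notempty)
    then have "\<exists>y\<in>C k. dist x y < infdist x (C k) + inverse (real (Suc k))"
      using that by (subst (asm) cINF_less_iff) (auto intro: bdd_belowI2[of _ 0])
    then have "\<exists>y. y \<in> C k \<and> dist y x \<le> infdist x (C k) + inverse (real (Suc k))"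
      by (auto simp: dist_commute intro: less_imp_le)
    then show ?thesis
      unfolding \<zeta>_def by (rule someI_ex)
  qed
  have "(\<lambda>k. infdist x (C k)) \<longlonglongrightarrow> 0"
  proof (rule order_tendstoI)
    fix a :: real
    assume "0 < a"
    from near[OF this] show "\<forall>\<^sub>F k in sequentially. infdist x (C k) < a"
      by (rule eventually_mono) (metis dist_commute infdist_le le_less_trans)
  qed (auto intro!: always_eventually intro: less_le_trans infdist_nonneg)
  from tendsto_add[OF this LIMSEQ_inverse_real_of_nat]
  have "(\<lambda>k. infdist x (C k) + inverse (real (Suc k))) \<longlonglongrightarrow> 0"
    by simp
  moreover have "\<forall>\<^sub>F k in sequentially. dist (\<zeta> k) x \<le> infdist x (C k) + inverse (real (Suc k))"
    using nonempty by (rule eventually_mono) (use pick in blast)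
  ultimately have "(\<lambda>k. dist (\<zeta> k) x) \<longlonglongrightarrow> 0"
    by (rule tendsto_sandwich[OF always_eventually[OF allI[OF zero_le_dist]] _ tendsto_const, rotated 1])
  then have "\<zeta> \<longlonglongrightarrow> x"
    by (rule iffD2[OF tendsto_dist_iff])
  moreover have "\<forall>\<^sub>F k in sequentially. \<zeta> k \<in> C k"
    using nonempty by (rule eventually_mono) (use pick in blast)
  ultimately show ?thesis
    unfolding PK_liminf_def by blast
qed

lemma PK_liminf_subset_limsup: "PK_liminf C \<subseteq> PK_limsup C"
proof
  fix x assume "x \<in> PK_liminf C"
  then obtain \<zeta> n where "\<And>k. n \<le> k \<Longrightarrow> \<zeta> k \<in> C k" and lim: "\<zeta> \<longlonglongrightarrow> x"
    by (auto simp: PK_liminf_def eventually_sequentially)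
  then have "strict_mono (\<lambda>j. j + n) \<and> (\<forall>j. \<zeta> (j + n) \<in> C (j + n)) \<and> (\<lambda>j. \<zeta> (j + n)) \<longlonglongrightarrow> x"
    by (auto simp: strict_mono_def intro: LIMSEQ_ignore_initial_segment)
  then show "x \<in> PK_limsup C"
    unfolding PK_limsup_def by (intro CollectI exI)
qed

text \<open>The limit along a subsequence is insensitive to its first term, so the inclusion at positive
  indices suffices.  Index \<open>0\<close> will stand for a partition without pieces, where the bounds are
  maxima of the empty set.\<close>

lemma PK_limsup_subset_closed:
  assumes "closed D" and sub: "\<And>k. 1 \<le> k \<Longrightarrow> C k \<subseteq> D"
  shows "PK_limsup C \<subseteq> D"
proof
  fix x assume "x \<in> PK_limsup C"
  then obtain \<kappa> \<zeta> where \<kappa>: "strict_mono (\<kappa> :: nat \<Rightarrow> nat)" and \<zeta>: "\<And>j. \<zeta> j \<in> C (\<kappa> j)"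
    and lim: "\<zeta> \<longlonglongrightarrow> x"
    by (auto simp: PK_limsup_def)
  have "\<zeta> j \<in> D" if "1 \<le> j" for j
    using sub[of "\<kappa> j"] \<zeta>[of j] strict_mono_imp_increasing[OF \<kappa>, of j] that by auto
  then have "\<forall>\<^sub>F j in sequentially. \<zeta> j \<in> D"
    by (auto simp: eventually_sequentially)
  with \<open>closed D\<close> lim show "x \<in> D"
    by (metis Lim_in_closed_set trivial_limit_sequentially)
qed

text \<open>Upper bounds make the approximating sets subsets of the limit set, which settles the outer limit.
  For the inner limit, a feasible \<open>w\<close> is moved a little towards the Slater point: by convexity
  every constraint becomes strict there, so consistency puts the new point into almost all
  approximating sets.  The Slater condition is what excludes feasible points that the
  upper bounds never reach.\<close>

theorem PK_converges_inner_approximation: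
  fixes M :: "'j \<Rightarrow> 'w::real_normed_vector \<Rightarrow> real"
  assumes "finite J"
    and convex: "\<And>j. j \<in> J \<Longrightarrow> convex_on W (M j)"
    and closed: "closed {w\<in>W. \<forall>j\<in>J. M j w \<le> c j}"
    and upper: "\<And>k j w. 1 \<le> k \<Longrightarrow> j \<in> J \<Longrightarrow> w \<in> W \<Longrightarrow> M j w \<le> U k j w"
    and consistent: "\<And>j w. j \<in> J \<Longrightarrow> w \<in> W \<Longrightarrow> M j w < c j \<Longrightarrow>
                       \<forall>\<^sub>F k in sequentially. U k j w \<le> c j"
    and "convex W" and "w0 \<in> W" and slater: "\<And>j. j \<in> J \<Longrightarrow> M j w0 < c j"
  shows "PK_converges (\<lambda>k. {w\<in>W. \<forall>j\<in>J. U k j w \<le> c j}) {w\<in>W. \<forall>j\<in>J. M j w \<le> c j}"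
    (is "PK_converges ?C ?D")
proof -
  have sup: "PK_limsup ?C \<subseteq> ?D"
    using closed by (rule PK_limsup_subset_closed) (use upper in \<open>fastforce intro: order_trans\<close>)
  have inf: "?D \<subseteq> PK_liminf ?C"
  proof
    fix w assume w: "w \<in> ?D"
    show "w \<in> PK_liminf ?C"
    proof (rule PK_liminfI_metric)
      fix e :: real assume "0 < e"
      \<comment> \<open>The displacement \<open>t * norm (w0 - w)\<close> stays below \<open>e\<close>; the \<open>1\<close> covers \<open>w0 = w\<close>.\<close>
      define t where "t = min (1/2) (e / (2 * (norm (w0 - w) + 1)))"
      have pos: "0 < 2 * (norm (w0 - w) + 1)"
        by (simp add: add_nonneg_pos)
      have t: "0 < t" "t < 1"
        using \<open>0 < e\<close> pos by (auto simp: t_def)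
      define v where "v = (1 - t) *\<^sub>R w + t *\<^sub>R w0"
      have v: "v \<in> W"
        unfolding v_def using \<open>convex W\<close> w \<open>w0 \<in> W\<close> t by (simp add: convexD)
      have "M j v < c j" if "j \<in> J" for j
      proof -
        have "M j v \<le> (1 - t) * M j w + t * M j w0"
          unfolding v_def using convex_onD[OF convex[OF that], of t w w0] w \<open>w0 \<in> W\<close> t by simp
        also have "\<dots> < (1 - t) * c j + t * c j"
          using w that slater[OF that] t
          by (intro add_le_less_mono mult_left_mono mult_strict_left_mono) auto
        finally show ?thesis
          by (simp add: algebra_simps)
      qed
      then have "\<forall>\<^sub>F k in sequentially. \<forall>j\<in>J. U k j v \<le> c j"
        using \<open>finite J\<close> v consistent by (simp add: eventually_ball_finite_distrib)
      moreover have "dist v w < e"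
      proof -
        have "v - w = t *\<^sub>R (w0 - w)"
          by (simp add: v_def algebra_simps)
        then have "dist v w = t * norm (w0 - w)"
          using t by (simp add: dist_norm)
        also have "\<dots> \<le> e / (2 * (norm (w0 - w) + 1)) * norm (w0 - w)"
          by (intro mult_right_mono) (auto simp: t_def)
        also have "\<dots> < e"
          using pos \<open>0 < e\<close> by (simp add: divide_simps algebra_simps add_strict_increasing)
        finally show ?thesis .
      qed
      ultimately show "\<forall>\<^sub>F k in sequentially. \<exists>y\<in>?C k. dist y w < e"
        using v by (auto elim!: eventually_mono)
    qed
  qed
  show ?thesis
    unfolding PK_converges_def using sup inf PK_liminf_subset_limsup by blast
qed

lemma convex_on_SUP_bounded_linear:
  fixes F :: "'t \<Rightarrow> 'w::real_normed_vector \<Rightarrow> real"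
  assumes "\<And>t. bounded_linear (F t)" and "T \<noteq> {}" and "\<And>w. bdd_above ((\<lambda>t. F t w) ` T)"
    and "convex W"
  shows "convex_on W (\<lambda>w. SUP t\<in>T. F t w)"
proof
  fix s :: real and x y
  assume s: "0 < s" "s < 1"
  show "(SUP t\<in>T. F t ((1 - s) *\<^sub>R x + s *\<^sub>R y)) \<le> (1 - s) * (SUP t\<in>T. F t x) + s * (SUP t\<in>T. F t y)"
  proof (rule cSUP_least[OF \<open>T \<noteq> {}\<close>])
    fix t assume t: "t \<in> T"
    interpret bounded_linear "F t"
      by fact
    have "F t ((1 - s) *\<^sub>R x + s *\<^sub>R y) = (1 - s) * F t x + s * F t y"
      by (simp add: add scaleR)
    also have "\<dots> \<le> (1 - s) * (SUP t\<in>T. F t x) + s * (SUP t\<in>T. F t y)"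
      using s t assms(3) by (intro add_mono mult_left_mono cSUP_upper) auto
    finally show "F t ((1 - s) *\<^sub>R x + s *\<^sub>R y) \<le> (1 - s) * (SUP t\<in>T. F t x) + s * (SUP t\<in>T. F t y)" .
  qed
qed fact

lemma closed_SUP_le_bounded_linear:
  fixes F :: "'t \<Rightarrow> 'w::real_normed_vector \<Rightarrow> real"
  assumes "\<And>t. bounded_linear (F t)" and "T \<noteq> {}" and "\<And>w. bdd_above ((\<lambda>t. F t w) ` T)"
  shows "closed {w. (SUP t\<in>T. F t w) \<le> c}"
proof -
  have "{w. (SUP t\<in>T. F t w) \<le> c} = (\<Inter>t\<in>T. {w. F t w \<le> c})"
    using assms(2,3) by (auto simp: cSUP_le_iff)
  moreover have "closed {w. F t w \<le> c}" for t
    by (intro closed_Collect_le linear_continuous_on assms continuous_on_const)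
  ultimately show ?thesis
    by auto
qed

section \<open>Smooth curves and dual norms\<close>

text \<open>Adding \<open>C x\<^sup>2 / 2\<close> to \<open>g\<close> makes the derivative nondecreasing, so the sum lies below its chords.
  The added parabola lies below its own chord by \<open>C (b - x) (x - a) / 2\<close>, which is the error term.
  The formula is multiplied by \<open>b - a\<close> to avoid fractions.\<close>

lemma le_chord_of_lipschitz_derivative:
  fixes g g' :: "real \<Rightarrow> real"
  assumes deriv: "\<And>x. x \<in> {0..1} \<Longrightarrow> (g has_vector_derivative g' x) (at x within {0..1})"
    and lip: "\<And>x y. x \<in> {0..1} \<Longrightarrow> y \<in> {0..1} \<Longrightarrow> x \<le> y \<Longrightarrow> g' x - g' y \<le> C * (y - x)"
    and "0 \<le> a" "a < x" "x < b" "b \<le> 1"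
  shows "(b - a) * g x \<le> (b - x) * g a + (x - a) * g b + C / 2 * (b - x) * (x - a) * (b - a)"
proof -
  define \<phi> where "\<phi> x = g x + C / 2 * x\<^sup>2" for x
  have d: "(\<phi> has_derivative (\<lambda>h. (g' x + C * x) * h)) (at x within {u..v})"
    if "0 \<le> u" "v \<le> 1" "u \<le> x" "x \<le> v" for u v x
  proof -
    have "(g has_real_derivative g' x) (at x within {u..v})"
      using deriv[of x] that
      by (auto simp: has_real_derivative_iff_has_vector_derivative
          intro: has_vector_derivative_within_subset)
    then have "(\<phi> has_real_derivative (g' x + C * x)) (at x within {u..v})"
      unfolding \<phi>_def by (auto intro!: derivative_eq_intros)
    then show ?thesis
      by (simp add: has_field_derivative_def)
  qed
  obtain s where s: "s \<in> {a<..<x}" "\<phi> x - \<phi> a = (g' s + C * s) * (x - a)"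
    using mvt_simple[of a x \<phi> "\<lambda>x h. (g' x + C * x) * h"] d[of a x] assms by auto
  obtain u where u: "u \<in> {x<..<b}" "\<phi> b - \<phi> x = (g' u + C * u) * (b - x)"
    using mvt_simple[of x b \<phi> "\<lambda>x h. (g' x + C * x) * h"] d[of x b] assms by auto
  have "g' s + C * s \<le> g' u + C * u"
    using lip[of s u] s u assms by (auto simp: algebra_simps)
  then have "(b - x) * (x - a) * (g' s + C * s) \<le> (b - x) * (x - a) * (g' u + C * u)"
    using assms by (intro mult_left_mono) auto
  then have "(b - x) * (\<phi> x - \<phi> a) \<le> (x - a) * (\<phi> b - \<phi> x)"
    using s u by (simp add: mult_ac)
  then show ?thesis
    unfolding \<phi>_def by (simp add: field_simps power2_eq_square)
qed

text \<open>On a mesh interval of length \<open>1/q\<close> the error of the chord is at most \<open>C (1/q)\<^sup>2 / 8\<close>, and the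
  chord lies below the larger of its end values.\<close>

lemma le_grid_value_of_lipschitz_derivative:
  fixes g g' :: "real \<Rightarrow> real"
  assumes deriv: "\<And>x. x \<in> {0..1} \<Longrightarrow> (g has_vector_derivative g' x) (at x within {0..1})"
    and lip: "\<And>x y. x \<in> {0..1} \<Longrightarrow> y \<in> {0..1} \<Longrightarrow> x \<le> y \<Longrightarrow> g' x - g' y \<le> C * (y - x)"
    and "0 \<le> C" "1 \<le> q" "x \<in> {0..1}"
  shows "\<exists>\<nu>\<in>{0..q}. g x \<le> g (real \<nu> / real q) + C / (8 * (real q)\<^sup>2)"
proof -
  define k where "k = nat \<lfloor>real q * x\<rfloor>"
  have q: "0 < real q"
    using \<open>1 \<le> q\<close> by simp
  have fl: "real k \<le> real q * x" "real q * x < real k + 1"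
    using \<open>x \<in> {0..1}\<close> by (auto simp: k_def)
  define a b where "a = real k / real q" and "b = real (Suc k) / real q"
  have ab: "a \<le> x" "x < b" "b - a = 1 / real q"
    using fl q by (auto simp: a_def b_def field_simps)
  show ?thesis
  proof (cases "x = a")
    case True
    have "real k \<le> real q"
      using fl \<open>x \<in> {0..1}\<close> mult_left_le[of x "real q"] by auto
    then show ?thesis
      using True \<open>0 \<le> C\<close> by (intro bexI[of _ k]) (auto simp: a_def)
  next
    case False
    have "real k < real q"
    proof -
      have "real k < real q * x"
        using False fl q by (simp add: a_def field_simps)
      also have "\<dots> \<le> real q"
        using \<open>x \<in> {0..1}\<close> by (simp add: mult_left_le)
      finally show ?thesis .
    qed
    then have kq: "Suc k \<le> q"
      by simp
    have "0 \<le> a" "b \<le> 1" "a < x"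
      using kq ab False q by (auto simp: a_def b_def field_simps)
    note chord = le_chord_of_lipschitz_derivative[OF deriv lip this(1,3) ab(2) this(2)]
    have "(b - a) * g x \<le> (b - x) * g a + (x - a) * g b + C / 2 * (b - x) * (x - a) * (b - a)"
      by (rule chord)
    \<comment> \<open>By the inequality of means, \<open>(b - x) (x - a) \<le> (b - a)\<^sup>2 / 4\<close>.\<close>
    also have "\<dots> \<le> (b - x) * max (g a) (g b) + (x - a) * max (g a) (g b)
                   + (C / 2 * ((b - a)\<^sup>2 / 4)) * (b - a)"
    proof (intro add_mono mult_left_mono mult_right_mono)
      have "(b - x) * (x - a) \<le> (b - a)\<^sup>2 / 4"
        using zero_le_power2[of "(b - x) - (x - a)"] by (simp add: power2_eq_square algebra_simps)
      then have "C / 2 * ((b - x) * (x - a)) \<le> C / 2 * ((b - a)\<^sup>2 / 4)"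
        using \<open>0 \<le> C\<close> by (intro mult_left_mono) auto
      then show "C / 2 * (b - x) * (x - a) \<le> C / 2 * ((b - a)\<^sup>2 / 4)"
        by (simp add: mult_ac)
    qed (use ab in auto)
    also have "\<dots> = (b - a) * (max (g a) (g b) + C / 8 * (b - a)\<^sup>2)"
      by (simp add: algebra_simps)
    finally have "g x \<le> max (g a) (g b) + C / 8 * (b - a)\<^sup>2"
      using ab by (simp only: mult_le_cancel_left_pos diff_gt_0_iff_gt)
    also have "C / 8 * (b - a)\<^sup>2 = C / (8 * (real q)\<^sup>2)"
      by (simp add: ab power_divide)
    finally have "g x \<le> max (g a) (g b) + C / (8 * (real q)\<^sup>2)" .
    then show ?thesis
      using kq by (cases "g a \<le> g b") (force simp: a_def b_def max_def)+
  qed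
qed

text \<open>The derivative is a limit of difference quotients, which stay in the subspace.  A norm given on
  \<open>V\<close> alone says something about derivatives of curves in \<open>V\<close> only because of this.\<close>

lemma vector_derivative_in_closed_subspace:
  fixes f :: "real \<Rightarrow> 'a::real_normed_vector"
  assumes "subspace V" "closed V" and "\<And>t. t \<in> S \<Longrightarrow> f t \<in> V" and "x \<in> S"
    and deriv: "(f has_vector_derivative D) (at x within S)" and "at x within S \<noteq> bot"
  shows "D \<in> V"
proof (rule Lim_in_closed_set[OF \<open>closed V\<close> _ \<open>at x within S \<noteq> bot\<close>])
  show "\<forall>\<^sub>F y in at x within S. (1 / (y - x)) *\<^sub>R (f y - f x) \<in> V"
    using assms by (auto simp: eventually_at_filter intro!: always_eventually subspace_scale subspace_diff)
  have "((\<lambda>y. (1 / norm (y - x)) *\<^sub>R (f y - (f x + (y - x) *\<^sub>R D))) \<longlongrightarrow> 0) (at x within S)"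
    using deriv by (simp add: has_vector_derivative_def has_derivative_within)
  then have "((\<lambda>y. norm ((1 / norm (y - x)) *\<^sub>R (f y - (f x + (y - x) *\<^sub>R D)))) \<longlongrightarrow> 0) (at x within S)"
    by (rule tendsto_norm_zero)
  moreover have "norm ((1 / norm (y - x)) *\<^sub>R (f y - (f x + (y - x) *\<^sub>R D)))
      = norm ((1 / (y - x)) *\<^sub>R (f y - f x) - D)" if "y \<noteq> x" for y
  proof -
    have "(1 / (y - x)) *\<^sub>R (f y - f x) - D = (1 / (y - x)) *\<^sub>R (f y - (f x + (y - x) *\<^sub>R D))"
      using that by (simp add: diff_diff_add[symmetric] scaleR_right_diff_distrib del: diff_diff_add)
    then show ?thesis
      by simp
  qed
  then have "\<forall>\<^sub>F y in at x within S. norm ((1 / norm (y - x)) *\<^sub>R (f y - (f x + (y - x) *\<^sub>R D)))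
      = norm ((1 / (y - x)) *\<^sub>R (f y - f x) - D)"
    unfolding eventually_at_filter by (intro always_eventually) blast
  ultimately have "((\<lambda>y. norm ((1 / (y - x)) *\<^sub>R (f y - f x) - D)) \<longlongrightarrow> 0) (at x within S)"
    by (rule Lim_transform_eventually)
  then show "((\<lambda>y. (1 / (y - x)) *\<^sub>R (f y - f x)) \<longlongrightarrow> D) (at x within S)"
    by (simp add: tendsto_norm_zero_iff Lim_null[of _ D])
qed

text \<open>The common setting for the spaces \<open>\<real>\<^bsup>n+ml\<^esup>\<close> (as subspaces of one space of stacks), \<open>\<real>\<^sup>m\<close> and
  \<open>\<real>\<^bsup>n+m\<^esup>\<close>.  The comparison \<open>norm_le\<close> of \<open>nrm\<close> with the ambient norm makes the supremum in the
  dual norm finite.\<close>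

locale normed_pairing =
  fixes V :: "'a::real_normed_vector set" and nrm :: "'a \<Rightarrow> real" and ip :: "'a \<Rightarrow> 'a \<Rightarrow> real"
  assumes norm_on: "norm_on V nrm"
    and subspace: "subspace V"
    and closed: "closed V"
    and norm_le: "\<exists>C. \<forall>v\<in>V. norm v \<le> C * nrm v"
    and bounded_linear_ip: "\<And>y. bounded_linear (\<lambda>v. ip v y)"
begin

abbreviation dual :: "'a \<Rightarrow> real" where
  "dual \<equiv> dual_norm ip V nrm"

lemma nrm_nonneg: "v \<in> V \<Longrightarrow> 0 \<le> nrm v"
  using norm_on by (simp add: norm_on_def)

lemma ip_scaleR: "ip (c *\<^sub>R v) y = c * ip v y"
  using linear_cmul[OF bounded_linear.linear[OF bounded_linear_ip]] by simp

lemma ip_diff: "ip (u - v) y = ip u y - ip v y"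
  using linear_diff[OF bounded_linear.linear[OF bounded_linear_ip]] by simp

lemma ip_zero: "ip 0 y = 0"
  using linear_0[OF bounded_linear.linear[OF bounded_linear_ip]] by simp

lemma bdd_above_ip: "bdd_above ((\<lambda>v. ip v y) ` {v\<in>V. nrm v \<le> 1})"
proof -
  obtain C where C: "\<And>v. v \<in> V \<Longrightarrow> norm v \<le> C * nrm v"
    using norm_le by blast
  obtain K where K: "0 \<le> K" "\<And>v. norm (ip v y) \<le> norm v * K"
    using bounded_linear.nonneg_bounded[OF bounded_linear_ip] by blast
  have "ip v y \<le> \<bar>C\<bar> * K" if "v \<in> V" "nrm v \<le> 1" for v
  proof -
    have "norm v \<le> \<bar>C\<bar> * nrm v"
      using C[OF that(1)] nrm_nonneg[OF that(1)] by (smt (verit) mult_right_mono)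
    also have "\<dots> \<le> \<bar>C\<bar>"
      using that by (simp add: mult_left_le)
    finally have "norm v * K \<le> \<bar>C\<bar> * K"
      using K by (intro mult_right_mono)
    with K(2)[of v] show ?thesis
      by simp
  qed
  then show ?thesis
    by (auto simp: bdd_above_def)
qed

lemma dual_nonneg: "0 \<le> dual y"
proof -
  have "nrm 0 = 0"
    using norm_on subspace by (simp add: norm_on_def subspace_0)
  then have "ip 0 y \<le> dual y"
    unfolding dual_norm_def using subspace
    by (intro cSUP_upper bdd_above_ip) (auto simp: subspace_0)
  then show ?thesis
    by (simp add: ip_zero)
qed

lemma ip_le:
  assumes "v \<in> V"
  shows "ip v y \<le> nrm v * dual y"
proof (cases "nrm v = 0")
  case True
  then have "v = 0"
    using norm_on assms by (simp add: norm_on_def)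
  then show ?thesis
    using True by (simp add: ip_zero)
next
  case False
  then have pos: "0 < nrm v"
    using nrm_nonneg[OF assms] by simp
  have "nrm ((1 / nrm v) *\<^sub>R v) = 1"
    using norm_on assms pos by (fastforce simp: norm_on_def)
  then have "ip ((1 / nrm v) *\<^sub>R v) y \<le> dual y"
    unfolding dual_norm_def using subspace assms
    by (intro cSUP_upper bdd_above_ip) (auto simp: subspace_scale)
  then show ?thesis
    using pos by (simp add: ip_scaleR field_simps)
qed

lemma ip_le_of_nrm_le:
  assumes "v \<in> V" "nrm v \<le> c"
  shows "ip v y \<le> c * dual y"
  using ip_le[OF assms(1), of y] mult_right_mono[OF assms(2) dual_nonneg[of y]] by linarith

lemma smooth_unitE:
  assumes "smooth_unit nrm L f" and "\<And>t. f t \<in> V"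
  obtains f' where "\<And>x. x \<in> {0..1} \<Longrightarrow> (f has_vector_derivative f' x) (at x within {0..1})"
    and "\<And>x. x \<in> {0..1} \<Longrightarrow> f' x \<in> V"
    and "\<And>x y. x \<in> {0..1} \<Longrightarrow> y \<in> {0..1} \<Longrightarrow> nrm (f' x - f' y) \<le> L * \<bar>x - y\<bar>"
proof -
  obtain f' where f': "\<And>x. x \<in> {0..1} \<Longrightarrow> (f has_vector_derivative f' x) (at x within {0..1})"
    and lip: "\<And>x y. x \<in> {0..1} \<Longrightarrow> y \<in> {0..1} \<Longrightarrow> nrm (f' x - f' y) \<le> L * \<bar>x - y\<bar>"
    using assms(1) unfolding smooth_unit_def by blast
  have "f' x \<in> V" if "x \<in> {0..1}" for x
    using vector_derivative_in_closed_subspace[OF subspace closed assms(2) that f'[OF that]] that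
    by (simp add: trivial_limit_within islimpt_Icc)
  with f' lip that show thesis
    by blast
qed

lemma smooth_unit_nonneg:
  assumes "smooth_unit nrm L f" and "\<And>t. f t \<in> V"
  shows "0 \<le> L"
proof -
  obtain f' where "\<And>x. x \<in> {0..1} \<Longrightarrow> f' x \<in> V"
    and "\<And>x y. x \<in> {0..1} \<Longrightarrow> y \<in> {0..1} \<Longrightarrow> nrm (f' x - f' y) \<le> L * \<bar>x - y\<bar>"
    using smooth_unitE[OF assms] by metis
  from this(2)[of 1 0] nrm_nonneg[of "f' 1 - f' 0"] this(1) subspace show ?thesis
    by (simp add: subspace_diff)
qed

text \<open>The scalar function \<open>x \<mapsto> \<langle>f x, y\<rangle>\<close> inherits from \<open>f\<close> a Lipschitz derivative, with constant
  \<open>L\<close> times the dual norm of \<open>y\<close>.  The chord bound even gives the factor \<open>1 / (8 q\<^sup>2)\<close>; the weaker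
  \<open>1 / (8 q)\<close> is the one that occurs in the piecewise bounds.\<close>

lemma ip_le_Max_nodes:
  assumes f: "smooth_unit nrm L f" "\<And>t. f t \<in> V" and "1 \<le> q" "x \<in> {0..1}"
  shows "ip (f x) y \<le> (MAX \<nu>\<in>{0..q}. ip (f (real \<nu> / real q)) y) + L / (8 * real q) * dual y"
proof -
  obtain f' where f': "\<And>x. x \<in> {0..1} \<Longrightarrow> (f has_vector_derivative f' x) (at x within {0..1})"
    and V: "\<And>x. x \<in> {0..1} \<Longrightarrow> f' x \<in> V"
    and lip: "\<And>x y. x \<in> {0..1} \<Longrightarrow> y \<in> {0..1} \<Longrightarrow> nrm (f' x - f' y) \<le> L * \<bar>x - y\<bar>"
    using smooth_unitE[OF f] by metis
  have L: "0 \<le> L"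
    by (rule smooth_unit_nonneg[OF f])
  have "\<exists>\<nu>\<in>{0..q}. ip (f x) y \<le> ip (f (real \<nu> / real q)) y + L * dual y / (8 * (real q)\<^sup>2)"
  proof (rule le_grid_value_of_lipschitz_derivative)
    show "((\<lambda>x. ip (f x) y) has_vector_derivative ip (f' x) y) (at x within {0..1})"
      if "x \<in> {0..1}" for x
      using bounded_linear.has_vector_derivative[OF bounded_linear_ip f'[OF that]] .
    show "ip (f' s) y - ip (f' t) y \<le> L * dual y * (t - s)"
      if "s \<in> {0..1}" "t \<in> {0..1}" "s \<le> t" for s t
      using ip_le_of_nrm_le[OF _ lip[OF that(1,2)], of y] V that subspace
      by (simp add: subspace_diff ip_diff mult_ac)
  qed (use assms L dual_nonneg in auto)
  then obtain \<nu> where \<nu>: "\<nu> \<in> {0..q}"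
      "ip (f x) y \<le> ip (f (real \<nu> / real q)) y + L * dual y / (8 * (real q)\<^sup>2)"
    by blast
  have "L * dual y / (8 * (real q)\<^sup>2) \<le> L * dual y / (8 * real q)"
    using \<open>1 \<le> q\<close> L dual_nonneg[of y]
    by (intro divide_left_mono) (auto simp: power2_eq_square)
  moreover have "ip (f (real \<nu> / real q)) y \<le> (MAX \<nu>\<in>{0..q}. ip (f (real \<nu> / real q)) y)"
    using \<nu>(1) by (intro Max_ge) auto
  ultimately show ?thesis
    using \<nu>(2) by simp
qed

lemma ip_le_lipschitz:
  assumes "lipschitz_unit nrm K f" and "\<And>t. f t \<in> V" and "s \<in> {0..1}" "t \<in> {0..1}"
  shows "ip (f s) y \<le> ip (f t) y + K * \<bar>s - t\<bar> * dual y"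
  using ip_le_of_nrm_le[of "f s - f t" "K * \<bar>s - t\<bar>" y] assms subspace
  by (simp add: lipschitz_unit_def subspace_diff ip_diff)

text \<open>The reparametrization \<open>g\<close> is there for \<open>\<tau> \<mapsto> \<tau>\<^sup>\<alpha>\<close>, which is continuous but need not be smooth
  at \<open>0\<close>.\<close>

lemma bdd_above_ip_smooth:
  assumes "smooth_unit nrm L f" "continuous_on S g" "g ` S \<subseteq> {0..1}" "compact S"
  shows "bdd_above ((\<lambda>x. ip (f (g x)) y) ` S)"
proof -
  have "continuous_on {0..1} f"
    using assms(1) unfolding smooth_unit_def continuous_on_eq_continuous_within
    by (metis has_vector_derivative_continuous)
  then have cont: "continuous_on S (\<lambda>x. ip (f (g x)) y)"
    using bounded_linear.continuous_on[OF bounded_linear_ip continuous_on_compose2[OF _ assms(2,3)]] by blast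
  show ?thesis
    by (rule bounded_imp_bdd_above[OF compact_imp_bounded[OF compact_continuous_image[OF cont \<open>compact S\<close>]]])
qed

end


section \<open>The spaces of stacked vectors\<close>

lemma lookup_scaleR: "Poly_Mapping.lookup (c *\<^sub>R u) k = c *\<^sub>R Poly_Mapping.lookup u k"
proof -
  have "finite {i. c *\<^sub>R Poly_Mapping.lookup u i \<noteq> 0}"
    by (rule finite_subset[OF _ finite_lookup[of u]]) auto
  then show ?thesis
    unfolding scaleR_poly_mapping_def by (simp add: Abs_poly_mapping_inverse)
qed

lemma norm_poly_mapping: "norm u = (\<Sum>k\<in>Poly_Mapping.keys u. norm (Poly_Mapping.lookup u k))"
  by (simp add: norm_poly_mapping_def dist_poly_mapping_def)

lemma norm_lookup_le: "norm (Poly_Mapping.lookup u k) \<le> norm u"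
proof (cases "k \<in> Poly_Mapping.keys u")
  case True
  then show ?thesis
    unfolding norm_poly_mapping by (intro member_le_sum) auto
qed (simp add: in_keys_iff)

lemma norm_single: "norm (Poly_Mapping.single k v) = norm v"
  by (simp add: norm_poly_mapping)

lemma bounded_linear_lookup: "bounded_linear (\<lambda>u. Poly_Mapping.lookup u k)"
  by (rule bounded_linear_intro[where K = 1])
     (auto simp: lookup_add lookup_scaleR norm_lookup_le)

lemma bounded_linear_single: "bounded_linear (Poly_Mapping.single k)"
  by (rule bounded_linear_intro[where K = 1])
     (auto simp: single_add norm_single lookup_scaleR lookup_single when_def intro!: poly_mapping_eqI)

lemmas bounded_linear_lookup_snd = bounded_linear_compose[OF bounded_linear_lookup bounded_linear_snd]

lemma norm_lookup_snd_le: "norm (Poly_Mapping.lookup (snd z) k) \<le> norm z"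
  using norm_lookup_le[of "snd z" k] norm_snd_le[of "snd z" "fst z"] by simp

lemma mem_stack_space: "z \<in> stack_space l \<longleftrightarrow> (\<forall>k\<ge>l. Poly_Mapping.lookup (snd z) k = 0)"
  unfolding stack_space_def by (auto simp: in_keys_iff subset_iff not_less[symmetric])

lemma subspace_stack_space: "subspace (stack_space l)"
  by (rule subspaceI) (auto simp: mem_stack_space lookup_add lookup_scaleR)

lemma closed_stack_space: "closed (stack_space l :: ('n::finite, 'm::finite) stack set)"
proof -
  have "(stack_space l :: ('n, 'm) stack set) = (\<Inter>k\<in>{l..}. {z. Poly_Mapping.lookup (snd z) k = 0})"
    by (auto simp: mem_stack_space)
  moreover have "closed {z :: ('n, 'm) stack. Poly_Mapping.lookup (snd z) k = 0}" for k
    by (intro closed_Collect_eq linear_continuous_on[OF bounded_linear_lookup_snd] continuous_on_const)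
  ultimately show ?thesis
    by auto
qed

lemma stack_inner_commute: "stack_inner v z = stack_inner z v"
proof -
  have "(\<Sum>k\<in>Poly_Mapping.keys (snd v). Poly_Mapping.lookup (snd v) k \<bullet> Poly_Mapping.lookup (snd z) k)
      = (\<Sum>k\<in>Poly_Mapping.keys (snd z). Poly_Mapping.lookup (snd z) k \<bullet> Poly_Mapping.lookup (snd v) k)"
    by (rule sum.mono_neutral_cong) (auto simp: in_keys_iff inner_commute)
  then show ?thesis
    by (simp add: stack_inner_def inner_commute)
qed

lemma bounded_linear_stack_inner_right: "bounded_linear (stack_inner v)"
  unfolding stack_inner_def
  by (intro bounded_linear_add bounded_linear_sum bounded_linear_inner_right_comp
      bounded_linear_fst bounded_linear_lookup_snd)

lemma bounded_linear_stack_inner_left: "bounded_linear (\<lambda>v. stack_inner v z)"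
  using bounded_linear_stack_inner_right[of z] by (simp add: stack_inner_commute[of _ z])

lemma compact_closed_subset:
  fixes S :: "'a::t2_space set"
  assumes "closed S" "compact K" "S \<subseteq> K"
  shows "compact S"
  using compact_Int_closed[OF assms(2,1)] assms(3) by (simp add: Int_absorb1)

text \<open>Induction on the number of blocks: splitting off the last block exhibits the set as a closed
  subset of a continuous image of a product of two compact sets.  The radius doubles because the
  shortened stack is a difference of two stacks of norm at most \<open>R\<close>.\<close>

lemma compact_stack_space_cball:
  "compact (stack_space l \<inter> cball 0 R :: ('n::finite, 'm::finite) stack set)"
proof (induction l arbitrary: R)
  case 0
  have "stack_space 0 \<inter> cball 0 R \<subseteq> cball (0::real^'n) R \<times> {0::nat \<Rightarrow>\<^sub>0 real^'m}"
    by (auto simp: mem_stack_space intro: poly_mapping_eqI order_trans[OF norm_fst_le])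
  moreover have "compact (cball (0::real^'n) R \<times> {0::nat \<Rightarrow>\<^sub>0 real^'m})"
    by (intro compact_Times) auto
  ultimately show ?case
    by (intro compact_closed_subset[OF closed_Int[OF closed_stack_space closed_cball]])
next
  case (Suc l)
  define emb :: "('n, 'm) stack \<times> (real^'m) \<Rightarrow> ('n, 'm) stack"
    where "emb p = fst p + (0, Poly_Mapping.single l (snd p))" for p
  let ?K = "emb ` ((stack_space l \<inter> cball 0 (2 * R)) \<times> cball 0 R)"
  have "stack_space (Suc l) \<inter> cball 0 R \<subseteq> ?K"
  proof
    fix z :: "('n, 'm) stack" assume z: "z \<in> stack_space (Suc l) \<inter> cball 0 R"
    define u where "u = Poly_Mapping.lookup (snd z) l"
    define z' where "z' = z - (0, Poly_Mapping.single l u)"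
    have u: "norm u \<le> R"
      using z norm_lookup_snd_le[of z l] by (simp add: u_def)
    have "norm z' \<le> norm z + norm (0::real^'n, Poly_Mapping.single l u)"
      unfolding z'_def by (rule norm_triangle_ineq4)
    then have "norm z' \<le> 2 * R"
      using z u by (simp add: norm_Pair norm_single)
    moreover have "Poly_Mapping.lookup (snd z') k = 0" if "l \<le> k" for k
      using z that by (cases "k = l")
        (auto simp: z'_def u_def lookup_minus lookup_single when_def mem_stack_space)
    ultimately show "z \<in> ?K"
      using u by (intro image_eqI[of _ _ "(z', u)"]) (auto simp: emb_def z'_def mem_stack_space)
  qed
  moreover have "compact ?K"
  proof (intro compact_continuous_image compact_Times compact_cball Suc.IH)
    show "continuous_on ((stack_space l \<inter> cball 0 (2 * R)) \<times> cball 0 R) emb"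
      unfolding emb_def
      by (intro continuous_intros linear_continuous_on bounded_linear_compose[OF bounded_linear_single]
          bounded_linear_snd)
  qed
  ultimately show ?case
    by (intro compact_closed_subset[OF closed_Int[OF closed_stack_space closed_cball]])
qed

text \<open>The usual argument for the equivalence of norms: \<open>nrm\<close> is Lipschitz by the bound in the other
  direction, and its minimum on the compact unit sphere is positive.\<close>

lemma norm_le_norm_on:
  fixes V :: "'a::real_normed_vector set"
  assumes norm_on: "norm_on V nrm" and "subspace V"
    and bound: "\<And>v. v \<in> V \<Longrightarrow> nrm v \<le> K * norm v" and "compact (V \<inter> cball 0 1)"
  shows "\<exists>C. \<forall>v\<in>V. norm v \<le> C * nrm v"
proof (cases "V \<inter> sphere 0 1 = {}")
  case True
  have "v = 0" if "v \<in> V" for v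
  proof (rule ccontr)
    assume "v \<noteq> 0"
    then have "(1 / norm v) *\<^sub>R v \<in> V \<inter> sphere 0 1"
      using that \<open>subspace V\<close> by (auto simp: subspace_scale)
    with True show False
      by blast
  qed
  then have "norm v \<le> 0 * nrm v" if "v \<in> V" for v
    using that by simp
  then show ?thesis
    by blast
next
  case False
  have S: "compact (V \<inter> sphere 0 1)"
  proof -
    have "closed {v :: 'a. norm v = 1}"
      by (intro closed_Collect_eq continuous_on_norm_id continuous_on_const)
    moreover have "sphere 0 1 = {v :: 'a. norm v = 1}"
      by auto
    ultimately have sphere_closed: "closed (sphere (0::'a) 1)"
      by simp
    have "V \<inter> sphere 0 1 = (V \<inter> cball 0 1) \<inter> sphere 0 1"
      by auto
    then show ?thesis
      using compact_Int_closed[OF assms(4), of "sphere 0 1"] sphere_closed by simp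
  qed
  have scale: "nrm (c *\<^sub>R v) = \<bar>c\<bar> * nrm v" if "v \<in> V" for c v
    using norm_on that by (simp add: norm_on_def)
  have lip: "nrm u - nrm v \<le> K * norm (u - v)" if "u \<in> V" "v \<in> V" for u v
  proof -
    have "u - v \<in> V"
      using that \<open>subspace V\<close> by (rule subspace_diff[rotated 1])
    then have "nrm ((u - v) + v) \<le> nrm (u - v) + nrm v"
      using norm_on that(2) unfolding norm_on_def by blast
    then show ?thesis
      using bound[OF \<open>u - v \<in> V\<close>] by simp
  qed
  have "\<bar>K\<bar>-lipschitz_on (V \<inter> sphere 0 1) nrm"
  proof (rule lipschitz_onI)
    fix u v assume "u \<in> V \<inter> sphere 0 1" "v \<in> V \<inter> sphere 0 1"
    then have "\<bar>nrm u - nrm v\<bar> \<le> K * norm (u - v)"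
      using lip[of u v] lip[of v u] by (simp add: norm_minus_commute)
    also have "\<dots> \<le> \<bar>K\<bar> * norm (u - v)"
      by (intro mult_right_mono) auto
    finally show "dist (nrm u) (nrm v) \<le> \<bar>K\<bar> * dist u v"
      by (simp add: dist_norm)
  qed simp
  then obtain s where s: "s \<in> V \<inter> sphere 0 1" "\<And>v. v \<in> V \<inter> sphere 0 1 \<Longrightarrow> nrm s \<le> nrm v"
    using continuous_attains_inf[OF S False] lipschitz_on_continuous_on by metis
  have pos: "0 < nrm s"
    using s(1) norm_on unfolding norm_on_def by (force simp: less_le)
  have "norm v \<le> 1 / nrm s * nrm v" if v: "v \<in> V" for v
  proof (cases "v = 0")
    case False
    have "(1 / norm v) *\<^sub>R v \<in> V \<inter> sphere 0 1"
      using v \<open>subspace V\<close> False by (auto simp: subspace_scale)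
    from s(2)[OF this] show ?thesis
      using False pos by (simp add: scale[OF v] field_simps)
  qed (use v norm_on in \<open>auto simp: norm_on_def\<close>)
  then show ?thesis
    by blast
qed

lemma norm_on_euclidean_le:
  fixes nrm :: "'a::euclidean_space \<Rightarrow> real"
  assumes norm_on: "norm_on UNIV nrm"
  shows "nrm v \<le> (\<Sum>e\<in>Basis. nrm e) * norm v"
proof -
  have sum: "nrm (\<Sum>e\<in>S. f e) \<le> (\<Sum>e\<in>S. nrm (f e))" if "finite S" for S and f :: "'a \<Rightarrow> 'a"
    using that
  proof induction
    case (insert e S)
    have "nrm (f e + (\<Sum>e\<in>S. f e)) \<le> nrm (f e) + nrm (\<Sum>e\<in>S. f e)"
      using norm_on by (simp add: norm_on_def)
    with insert show ?case
      by simp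
  qed (use norm_on in \<open>auto simp: norm_on_def intro: eq_refl\<close>)
  have "nrm v = nrm (\<Sum>e\<in>Basis. (v \<bullet> e) *\<^sub>R e)"
    by (simp add: euclidean_representation)
  also have "\<dots> \<le> (\<Sum>e\<in>Basis. nrm ((v \<bullet> e) *\<^sub>R e))"
    by (simp add: sum)
  also have "\<dots> \<le> (\<Sum>e\<in>Basis. nrm e * norm v)"
  proof (rule sum_mono)
    fix e :: 'a assume "e \<in> Basis"
    then have "\<bar>v \<bullet> e\<bar> * nrm e \<le> norm v * nrm e"
      using norm_on by (intro mult_right_mono Basis_le_norm) (auto simp: norm_on_def)
    then show "nrm ((v \<bullet> e) *\<^sub>R e) \<le> nrm e * norm v"
      using norm_on by (simp add: norm_on_def mult.commute)
  qed
  finally show ?thesis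
    by (simp add: sum_distrib_right)
qed

lemma norm_on_subset: "norm_on V nrm \<Longrightarrow> U \<subseteq> V \<Longrightarrow> norm_on U nrm"
  by (auto simp: norm_on_def subset_iff)

lemma norm_on_linear_embedding:
  assumes norm_on: "norm_on V nrm" and "linear T" "inj T" "range T \<subseteq> V"
  shows "norm_on UNIV (\<lambda>x. nrm (T x))"
proof -
  have "T x \<in> V" for x
    using assms(4) by blast
  then show ?thesis
    using norm_on \<open>inj T\<close> unfolding norm_on_def
    by (simp add: linear_add[OF \<open>linear T\<close>] linear_cmul[OF \<open>linear T\<close>]
        linear_injective_0[OF \<open>linear T\<close>] linear_0[OF \<open>linear T\<close>] )
       (metis linear_0[OF \<open>linear T\<close>] linear_injective_0[OF \<open>linear T\<close>])
qed

text \<open>The triangle inequality over the blocks, each of which ranges over a Euclidean space.\<close>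

lemma norm_on_stack_le:
  assumes "norm_on (stack_space l) nrm"
  shows "\<exists>K. \<forall>z\<in>stack_space l. nrm z \<le> K * norm z"
  using assms
proof (induction l)
  case 0
  have "norm_on UNIV (\<lambda>x::real^'a. nrm (x, 0))"
    by (rule norm_on_linear_embedding[OF 0])
       (auto simp: linear_iff inj_on_def mem_stack_space)
  note bound = norm_on_euclidean_le[OF this]
  have "nrm z \<le> (\<Sum>e\<in>Basis. nrm (e, 0)) * norm z" if "z \<in> stack_space 0" for z
  proof -
    have "z = (fst z, 0)"
      using that by (auto simp: mem_stack_space intro!: prod_eqI poly_mapping_eqI)
    then show ?thesis
      using bound[of "fst z"] by (metis add.right_neutral norm_Pair norm_zero power_zero_numeral
          real_sqrt_abs abs_norm_cancel)
  qed
  then show ?case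
    by blast
next
  case (Suc l)
  have "norm_on UNIV (\<lambda>u. nrm (0, Poly_Mapping.single l u))"
    by (rule norm_on_linear_embedding[OF Suc.prems])
       (auto simp: linear_iff inj_on_def mem_stack_space lookup_single when_def
         linear_cmul[OF bounded_linear.linear[OF bounded_linear_single]]
         linear_add[OF bounded_linear.linear[OF bounded_linear_single]]
         dest!: arg_cong[where f = "\<lambda>u. Poly_Mapping.lookup u l"])
  note last = norm_on_euclidean_le[OF this]
  let ?L = "\<Sum>e\<in>Basis. nrm (0, Poly_Mapping.single l e)"
  have sub: "stack_space l \<subseteq> stack_space (Suc l)"
    by (auto simp: mem_stack_space)
  obtain K where K: "\<And>z. z \<in> stack_space l \<Longrightarrow> nrm z \<le> K * norm z"
    using Suc.IH[OF norm_on_subset[OF Suc.prems sub]] by blast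
  have L: "0 \<le> ?L"
    using Suc.prems unfolding norm_on_def
    by (intro sum_nonneg) (auto simp: mem_stack_space lookup_single when_def)
  have "nrm z \<le> (2 * \<bar>K\<bar> + ?L) * norm z" if z: "z \<in> stack_space (Suc l)" for z
  proof -
    define u where "u = Poly_Mapping.lookup (snd z) l"
    define e where "e = (0 :: real^'a, Poly_Mapping.single l u)"
    have e: "e \<in> stack_space (Suc l)" and "z - e \<in> stack_space l"
      using z by (auto simp: e_def u_def mem_stack_space lookup_minus lookup_single when_def le_Suc_eq Suc_le_eq)
    have u: "norm u \<le> norm z"
      unfolding u_def by (rule norm_lookup_snd_le)
    have "norm (z - e) \<le> norm z + norm e"
      by (rule norm_triangle_ineq4)
    also have "norm e = norm u"
      by (simp add: e_def norm_Pair norm_single)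
    finally have ze: "norm (z - e) \<le> 2 * norm z"
      using u by simp
    have "nrm ((z - e) + e) \<le> nrm (z - e) + nrm e"
      using Suc.prems \<open>z - e \<in> stack_space l\<close> sub e unfolding norm_on_def by blast
    also have "nrm (z - e) \<le> \<bar>K\<bar> * norm (z - e)"
      using K[OF \<open>z - e \<in> stack_space l\<close>] by (rule order_trans) (auto intro: mult_right_mono)
    also have "\<dots> \<le> \<bar>K\<bar> * (2 * norm z)"
      using ze by (intro mult_left_mono) auto
    also have "nrm e \<le> ?L * norm u"
      unfolding e_def by (rule last)
    also have "\<dots> \<le> ?L * norm z"
      using u L by (intro mult_left_mono)
    finally show ?thesis
      by (simp add: algebra_simps)
  qed
  then show ?case
    by blast
qed

lemma normed_pairing_euclidean:
  fixes nrm :: "'a::euclidean_space \<Rightarrow> real"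
  assumes "norm_on UNIV nrm"
  shows "normed_pairing UNIV nrm (\<bullet>)"
proof (rule normed_pairing.intro)
  show "\<exists>C. \<forall>v\<in>UNIV. norm v \<le> C * nrm v"
    using norm_on_euclidean_le[OF assms] by (intro norm_le_norm_on[OF assms]) auto
qed (auto intro: assms bounded_linear_inner_left)

lemma normed_pairing_stack:
  assumes "norm_on (stack_space l) nrm"
  shows "normed_pairing (stack_space l) nrm stack_inner"
proof (rule normed_pairing.intro)
  show "\<exists>C. \<forall>v\<in>stack_space l. norm v \<le> C * nrm v"
    using norm_on_stack_le[OF assms]
    by (auto intro: norm_le_norm_on[OF assms subspace_stack_space _ compact_stack_space_cball])
qed (auto intro: assms subspace_stack_space closed_stack_space bounded_linear_stack_inner_left)


section \<open>Piecewise bounds and the exact constraint functions\<close>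

text \<open>For \<open>t \<in> [0,1]\<close> one has \<open>t \<le> t\<^sup>\<alpha>\<close>; this is applied to the fractions \<open>x/(x+y)\<close> and \<open>y/(x+y)\<close>, whose
  sum is \<open>1\<close>.\<close>

lemma powr_add_le:
  fixes x y \<alpha> :: real
  assumes "0 < \<alpha>" "\<alpha> \<le> 1" "0 \<le> x" "0 \<le> y"
  shows "(x + y) powr \<alpha> \<le> x powr \<alpha> + y powr \<alpha>"
proof (cases "x + y = 0")
  case False
  then have pos: "0 < x + y"
    using assms by simp
  have frac: "u / (x + y) \<le> u powr \<alpha> / (x + y) powr \<alpha>" if "0 \<le> u" "u \<le> x + y" for u
    using powr_mono'[of \<alpha> 1 "u / (x + y)"] assms pos that by (simp add: powr_divide)
  have "1 = x / (x + y) + y / (x + y)"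
    using pos by (simp add: add_divide_distrib[symmetric])
  also have "\<dots> \<le> (x powr \<alpha> + y powr \<alpha>) / (x + y) powr \<alpha>"
    using frac[of x] frac[of y] assms by (simp add: add_divide_distrib)
  finally show ?thesis
    using pos by (simp add: field_simps)
qed (use assms in auto)

text \<open>By subadditivity of \<open>x \<mapsto> x\<^sup>\<alpha>\<close>, all cells of the graded mesh in the variable \<open>\<rho> = \<tau>\<^sup>\<alpha>\<close> have length
  at most \<open>N\<^sub>s\<^bsup>-\<alpha>\<^esup>\<close>, although they correspond to cells of length \<open>1/N\<^sub>s\<close> in \<open>\<tau>\<close>.\<close>

lemma grid_gap:
  assumes "0 < \<alpha>" "\<alpha> \<le> 1" "1 \<le> Ns"
  shows "0 < grid \<alpha> Ns (Suc r) - grid \<alpha> Ns r"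
    and "grid \<alpha> Ns (Suc r) - grid \<alpha> Ns r \<le> (1 / real Ns) powr \<alpha>"
proof -
  show "0 < grid \<alpha> Ns (Suc r) - grid \<alpha> Ns r"
    unfolding grid_def using assms powr_less_mono2[of \<alpha> "real r / real Ns" "real (Suc r) / real Ns"]
    by (simp add: divide_strict_right_mono)
  show "grid \<alpha> Ns (Suc r) - grid \<alpha> Ns r \<le> (1 / real Ns) powr \<alpha>"
    unfolding grid_def using assms powr_add_le[of \<alpha> "real r / real Ns" "1 / real Ns"]
    by (simp add: add_divide_distrib add.commute)
qed

lemma unit_interval_piece:
  assumes "1 \<le> Ns" "x \<in> {0..1::real}"
  obtains r where "r < Ns" "real r / real Ns \<le> x" "x \<le> real (Suc r) / real Ns"
proof (cases "x = 1")
  case True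
  then show ?thesis
    using that[of "Ns - 1"] assms(1) by (auto simp: field_simps of_nat_diff)
next
  case False
  define r where "r = nat \<lfloor>real Ns * x\<rfloor>"
  have fl: "real r \<le> real Ns * x" "real Ns * x < real r + 1"
    using assms by (auto simp: r_def)
  moreover have "real Ns * x < real Ns"
    using assms False by auto
  ultimately have "r < Ns"
    by linarith
  with fl that[of r] assms(1) show ?thesis
    by (auto simp: field_simps)
qed

lemma node_mem_unit_interval: "\<nu> \<in> {0..q} \<Longrightarrow> real \<nu> / real q \<in> {0..1}"
  by (cases "q = 0") auto

lemma piece_mem_unit_interval:
  assumes "r < Ns" "\<theta> \<in> {0..1}"
  shows "(real r + \<theta>) / real Ns \<in> {0..1}"
proof -
  have "real r + 1 \<le> real Ns"
    using assms by simp
  then show ?thesis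
    using assms by auto
qed

lemma psi_ns_eq_hat: "psi_ns \<alpha> h A B H i \<tau> = psi_ns_hat \<alpha> h A B H i (\<tau> powr \<alpha>)"
  by (simp add: psi_ns_def psi_ns_hat_def)

lemma psi_sm_mem_stack_space: "psi_sm \<alpha> h A B H l i \<tau> \<in> stack_space l"
  by (simp add: psi_sm_def mem_stack_space lookup_blocks)

lemma Max_image_obtain:
  fixes f :: "'a \<Rightarrow> 'b::linorder"
  assumes "finite S" "S \<noteq> {}"
  obtains x where "x \<in> S" "(MAX x\<in>S. f x) = f x"
  using Max_in[of "f ` S"] assms by (metis finite_imageI image_is_empty imageE)

lemma bdd_above_psi_zero_hat:
  assumes "norm_on UNIV n0" "smooth_unit n0 L (psi_zero_hat \<alpha> h A B H i)"
  shows "bdd_above ((\<lambda>\<rho>. psi_zero_hat \<alpha> h A B H i \<rho> \<bullet> y) ` {0..1})"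
  by (rule normed_pairing.bdd_above_ip_smooth[OF normed_pairing_euclidean[OF assms(1)] assms(2), of _ "\<lambda>x. x"])
     (auto intro: continuous_on_id)

text \<open>Every \<open>\<rho>\<close> lies in some piece, and there the node bound applies to the local map.\<close>

lemma M_zero_le_B_zero:
  assumes "norm_on UNIV n0" "1 \<le> Ns" "1 \<le> q"
    and smooth: "\<And>r. r < Ns \<Longrightarrow> smooth_unit n0 (L r) (local_zero \<alpha> h A B H Ns i r)"
  shows "M_zero \<alpha> h A B H i y \<le> B_zero \<alpha> h A B H n0 L q Ns i y"
  unfolding M_zero_def
proof (rule cSUP_least)
  fix \<rho> :: real assume "\<rho> \<in> {0..1}"
  then obtain r where r: "r < Ns" "real r / real Ns \<le> \<rho>" "\<rho> \<le> real (Suc r) / real Ns"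
    using unit_interval_piece \<open>1 \<le> Ns\<close> by metis
  define \<theta> where "\<theta> = real Ns * \<rho> - real r"
  have \<theta>: "\<theta> \<in> {0..1}"
    using r \<open>1 \<le> Ns\<close> by (auto simp: \<theta>_def field_simps)
  have "psi_zero_hat \<alpha> h A B H i \<rho> = local_zero \<alpha> h A B H Ns i r \<theta>"
    using \<open>1 \<le> Ns\<close> by (simp add: local_zero_def \<theta>_def)
  then have "psi_zero_hat \<alpha> h A B H i \<rho> \<bullet> y \<le> B_zero_piece \<alpha> h A B H n0 L q Ns i r y"
    unfolding B_zero_piece_def
    using normed_pairing.ip_le_Max_nodes[OF normed_pairing_euclidean[OF assms(1)] smooth[OF r(1)] _ \<open>1 \<le> q\<close> \<theta>]
    by simp
  also have "\<dots> \<le> B_zero \<alpha> h A B H n0 L q Ns i y"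
    unfolding B_zero_def using r by (intro Max_ge) auto
  finally show "psi_zero_hat \<alpha> h A B H i \<rho> \<bullet> y \<le> B_zero \<alpha> h A B H n0 L q Ns i y" .
qed auto

text \<open>The nodes are points of the exact curve, so only the correction terms exceed the supremum.\<close>

lemma B_zero_le:
  assumes "norm_on UNIV n0" "1 \<le> Ns" "1 \<le> q"
    and smooth: "smooth_unit n0 L (psi_zero_hat \<alpha> h A B H i)"
    and L: "\<And>r. r < Ns \<Longrightarrow> Lloc r \<le> L / (real Ns)\<^sup>2"
  shows "B_zero \<alpha> h A B H n0 Lloc q Ns i y
    \<le> M_zero \<alpha> h A B H i y + L / (real Ns)\<^sup>2 / (8 * real q) * dual_norm (\<bullet>) UNIV n0 y"
proof -
  interpret normed_pairing UNIV n0 "(\<bullet>)"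
    by (rule normed_pairing_euclidean) fact
  obtain r where r: "r < Ns" "B_zero \<alpha> h A B H n0 Lloc q Ns i y = B_zero_piece \<alpha> h A B H n0 Lloc q Ns i r y"
    unfolding B_zero_def using \<open>1 \<le> Ns\<close>
    by (rule_tac Max_image_obtain[of "{0..<Ns}" "\<lambda>r. B_zero_piece \<alpha> h A B H n0 Lloc q Ns i r y"]) auto
  obtain \<nu> where \<nu>: "\<nu> \<in> {0..q}"
    "(MAX \<nu>\<in>{0..q}. local_zero \<alpha> h A B H Ns i r (real \<nu> / real q) \<bullet> y)
      = local_zero \<alpha> h A B H Ns i r (real \<nu> / real q) \<bullet> y"
    by (rule Max_image_obtain[of "{0..q}" "\<lambda>\<nu>. local_zero \<alpha> h A B H Ns i r (real \<nu> / real q) \<bullet> y"]) auto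
  have "local_zero \<alpha> h A B H Ns i r (real \<nu> / real q) \<bullet> y \<le> M_zero \<alpha> h A B H i y"
    unfolding local_zero_def M_zero_def
    by (intro cSUP_upper bdd_above_psi_zero_hat[OF assms(1) smooth]
        piece_mem_unit_interval[OF r(1) node_mem_unit_interval[OF \<nu>(1)]])
  moreover have "Lloc r / (8 * real q) * dual y \<le> L / (real Ns)\<^sup>2 / (8 * real q) * dual y"
    using L[OF r(1)] dual_nonneg by (intro mult_right_mono divide_right_mono) auto
  ultimately show ?thesis
    unfolding r(2) B_zero_piece_def \<nu>(2) by linarith
qed

lemma bdd_above_psi_pos:
  assumes "0 < \<alpha>" "norm_on (stack_space l) nz" "norm_on UNIV nu"
    and "smooth_unit nz L (psi_sm \<alpha> h A B H l i)"
    and "smooth_unit nu L' (psi_ns_hat \<alpha> h A B H i)"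
  shows "bdd_above ((\<lambda>\<tau>. stack_inner (psi_sm \<alpha> h A B H l i \<tau>) z + psi_ns \<alpha> h A B H i \<tau> \<bullet> u) ` {0..1})"
proof -
  have sm: "bdd_above ((\<lambda>\<tau>. stack_inner (psi_sm \<alpha> h A B H l i \<tau>) z) ` {0..1})"
    by (rule normed_pairing.bdd_above_ip_smooth[OF normed_pairing_stack[OF assms(2)] assms(4), of _ "\<lambda>x. x"])
       (auto intro: continuous_on_id)
  have ns: "bdd_above ((\<lambda>\<tau>. psi_ns_hat \<alpha> h A B H i (\<tau> powr \<alpha>) \<bullet> u) ` {0..1})"
  proof (rule normed_pairing.bdd_above_ip_smooth[OF normed_pairing_euclidean[OF assms(3)] assms(5)])
    show "continuous_on {0..1} (\<lambda>\<tau>::real. \<tau> powr \<alpha>)"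
      using \<open>0 < \<alpha>\<close> by (intro continuous_on_powr' continuous_on_id continuous_on_const) auto
    show "(\<lambda>\<tau>. \<tau> powr \<alpha>) ` {0..1} \<subseteq> {0..1::real}"
      using \<open>0 < \<alpha>\<close> by (auto intro!: powr_le1)
  qed auto
  show ?thesis
    unfolding psi_ns_eq_hat
    by (rule bdd_aboveI2, rule add_mono[OF cSUP_upper[OF _ sm] cSUP_upper[OF _ ns]])
qed

text \<open>The meshes match: \<open>\<tau>\<close> lies in the \<open>r\<close>-th uniform cell exactly if \<open>\<tau>\<^sup>\<alpha>\<close> lies in the \<open>r\<close>-th graded
  cell.  Hence the two node bounds, each in its own local coordinate \<open>\<theta>\<close> or \<open>\<eta>\<close>, concern the same
  piece.\<close>

lemma M_pos_le_B_pos: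
  assumes "0 < \<alpha>" "\<alpha> \<le> 1" "norm_on (stack_space l) nz" "norm_on UNIV nu" "1 \<le> Ns" "1 \<le> q"
    and sm: "\<And>r. r < Ns \<Longrightarrow> smooth_unit nz (Lsm r) (local_sm \<alpha> h A B H Ns l i r)"
    and ns: "\<And>r. r < Ns \<Longrightarrow> smooth_unit nu (Lns r) (local_ns \<alpha> h A B H Ns i r)"
  shows "M_pos \<alpha> h A B H l i y \<le> B_pos \<alpha> h A B H nz nu Lsm Lns q Ns l i y"
  unfolding M_pos_def
proof (rule cSUP_least)
  fix \<tau> :: real assume \<tau>: "\<tau> \<in> {0..1}"
  then obtain r where r: "r < Ns" "real r / real Ns \<le> \<tau>" "\<tau> \<le> real (Suc r) / real Ns"
    using unit_interval_piece \<open>1 \<le> Ns\<close> by metis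
  define \<theta> where "\<theta> = real Ns * \<tau> - real r"
  have \<theta>: "\<theta> \<in> {0..1}"
    using r \<open>1 \<le> Ns\<close> by (auto simp: \<theta>_def field_simps)
  have sm_eq: "psi_sm \<alpha> h A B H l i \<tau> = local_sm \<alpha> h A B H Ns l i r \<theta>"
    using \<open>1 \<le> Ns\<close> by (simp add: local_sm_def \<theta>_def)
  define \<eta> where "\<eta> = (\<tau> powr \<alpha> - grid \<alpha> Ns r) / (grid \<alpha> Ns (Suc r) - grid \<alpha> Ns r)"
  note gap = grid_gap(1)[OF assms(1,2,5), of r]
  have "grid \<alpha> Ns r \<le> \<tau> powr \<alpha>" "\<tau> powr \<alpha> \<le> grid \<alpha> Ns (Suc r)"
    unfolding grid_def using r \<tau> \<open>0 < \<alpha>\<close> by (auto intro!: powr_mono2)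
  then have \<eta>: "\<eta> \<in> {0..1}"
    using gap by (auto simp: \<eta>_def)
  have ns_eq: "psi_ns \<alpha> h A B H i \<tau> = local_ns \<alpha> h A B H Ns i r \<eta>"
    using gap by (simp add: psi_ns_eq_hat local_ns_def \<eta>_def)
  have "stack_inner (psi_sm \<alpha> h A B H l i \<tau>) (fst y) + psi_ns \<alpha> h A B H i \<tau> \<bullet> snd y
      \<le> B_pos_piece \<alpha> h A B H nz nu Lsm Lns q Ns l i r y"
    unfolding B_pos_piece_def sm_eq ns_eq
    using normed_pairing.ip_le_Max_nodes[OF normed_pairing_stack[OF assms(3)] sm[OF r(1)] _ \<open>1 \<le> q\<close> \<theta>, of "fst y"]
      normed_pairing.ip_le_Max_nodes[OF normed_pairing_euclidean[OF assms(4)] ns[OF r(1)] _ \<open>1 \<le> q\<close> \<eta>, of "snd y"]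
    by (simp add: local_sm_def psi_sm_mem_stack_space)
  also have "\<dots> \<le> B_pos \<alpha> h A B H nz nu Lsm Lns q Ns l i y"
    unfolding B_pos_def using r by (intro Max_ge) auto
  finally show "stack_inner (psi_sm \<alpha> h A B H l i \<tau>) (fst y) + psi_ns \<alpha> h A B H i \<tau> \<bullet> snd y
      \<le> B_pos \<alpha> h A B H nz nu Lsm Lns q Ns l i y" .
qed auto

text \<open>The two maxima over the nodes may be attained at different times.  The node
  \<open>\<rho>\<close> of the nonsmooth part belongs to the time \<open>\<tau> = \<rho>\<^bsup>1/\<alpha>\<^esup>\<close>, which lies in the same cell of length
  \<open>1/N\<^sub>s\<close> as the time \<open>\<sigma>\<close> of the smooth part; the Lipschitz constant of the smooth part pays for moving
  \<open>\<sigma>\<close> to \<open>\<tau>\<close>, where the sum of both parts is at most the supremum.\<close>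

lemma B_pos_le:
  assumes "0 < \<alpha>" "\<alpha> \<le> 1" "norm_on (stack_space l) nz" "norm_on UNIV nu" "1 \<le> Ns" "1 \<le> q"
    and sm: "smooth_unit nz Lsm (psi_sm \<alpha> h A B H l i)"
    and ns: "smooth_unit nu Lns (psi_ns_hat \<alpha> h A B H i)"
    and lip: "lipschitz_unit nz K (psi_sm \<alpha> h A B H l i)"
    and Lsm: "\<And>r. r < Ns \<Longrightarrow> Lsm_loc r \<le> Lsm / (real Ns)\<^sup>2"
    and Lns: "\<And>r. r < Ns \<Longrightarrow> Lns_loc r \<le> Lns * (grid \<alpha> Ns (Suc r) - grid \<alpha> Ns r)\<^sup>2"
  shows "B_pos \<alpha> h A B H nz nu Lsm_loc Lns_loc q Ns l i y
    \<le> M_pos \<alpha> h A B H l i y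
      + \<bar>K\<bar> * (1 / real Ns) * dual_norm stack_inner (stack_space l) nz (fst y)
      + Lsm / (real Ns)\<^sup>2 / (8 * real q) * dual_norm stack_inner (stack_space l) nz (fst y)
      + Lns * ((1 / real Ns) powr \<alpha>)\<^sup>2 / (8 * real q) * dual_norm (\<bullet>) UNIV nu (snd y)"
proof -
  interpret z: normed_pairing "stack_space l" nz stack_inner
    by (rule normed_pairing_stack) fact
  interpret u: normed_pairing UNIV nu "(\<bullet>)"
    by (rule normed_pairing_euclidean) fact
  let ?P = "\<lambda>r. B_pos_piece \<alpha> h A B H nz nu Lsm_loc Lns_loc q Ns l i r y"
  obtain r where r: "r < Ns" "B_pos \<alpha> h A B H nz nu Lsm_loc Lns_loc q Ns l i y = ?P r"
    unfolding B_pos_def using \<open>1 \<le> Ns\<close> by (rule_tac Max_image_obtain[of "{0..<Ns}" ?P]) auto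
  let ?s = "\<lambda>\<nu>. stack_inner (local_sm \<alpha> h A B H Ns l i r (real \<nu> / real q)) (fst y)"
  obtain \<nu> where \<nu>: "\<nu> \<in> {0..q}" "(MAX \<nu>\<in>{0..q}. ?s \<nu>) = ?s \<nu>"
    by (rule Max_image_obtain[of "{0..q}" ?s]) auto
  let ?n = "\<lambda>\<nu>. local_ns \<alpha> h A B H Ns i r (real \<nu> / real q) \<bullet> snd y"
  obtain \<nu>' where \<nu>': "\<nu>' \<in> {0..q}" "(MAX \<nu>\<in>{0..q}. ?n \<nu>) = ?n \<nu>'"
    by (rule Max_image_obtain[of "{0..q}" ?n]) auto
  define \<rho> where "\<rho> = grid \<alpha> Ns r + real \<nu>' / real q * (grid \<alpha> Ns (Suc r) - grid \<alpha> Ns r)"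
  define \<tau> where "\<tau> = \<rho> powr (1 / \<alpha>)"
  define \<sigma> where "\<sigma> = (real r + real \<nu> / real q) / real Ns"
  note gap = grid_gap[OF assms(1,2,5), of r]
  have t: "0 \<le> real \<nu>' / real q" "real \<nu>' / real q \<le> 1"
    using node_mem_unit_interval[OF \<nu>'(1)] by auto
  have \<rho>: "grid \<alpha> Ns r \<le> \<rho>" "\<rho> \<le> grid \<alpha> Ns (Suc r)"
    using gap(1) t mult_right_mono[OF t(2), of "grid \<alpha> Ns (Suc r) - grid \<alpha> Ns r"]
    by (auto simp: \<rho>_def)
  have root: "grid \<alpha> Ns k powr (1 / \<alpha>) = real k / real Ns" for k
    using \<open>0 < \<alpha>\<close> by (simp add: grid_def powr_powr)
  have "0 \<le> grid \<alpha> Ns r"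
    by (simp add: grid_def)
  then have \<tau>: "real r / real Ns \<le> \<tau>" "\<tau> \<le> real (Suc r) / real Ns" and \<tau>_powr: "\<tau> powr \<alpha> = \<rho>"
    using \<rho> \<open>0 < \<alpha>\<close> powr_mono2[of "1 / \<alpha>" "grid \<alpha> Ns r" \<rho>]
      powr_mono2[of "1 / \<alpha>" \<rho> "grid \<alpha> Ns (Suc r)"]
    unfolding root \<tau>_def by (auto simp: powr_powr)
  have \<sigma>: "real r / real Ns \<le> \<sigma>" "\<sigma> \<le> real (Suc r) / real Ns" "\<sigma> \<in> {0..1}"
    using node_mem_unit_interval[OF \<nu>(1)] piece_mem_unit_interval[OF r(1) node_mem_unit_interval[OF \<nu>(1)]]
    by (auto simp: \<sigma>_def intro!: divide_right_mono)
  have "real (Suc r) / real Ns \<le> 1"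
    using r by simp
  moreover have "0 \<le> \<tau>"
    by (simp add: \<tau>_def)
  ultimately have \<tau>01: "\<tau> \<in> {0..1}"
    using \<tau> by (simp del: of_nat_Suc)
  have dist: "\<bar>\<sigma> - \<tau>\<bar> \<le> 1 / real Ns"
    using \<tau> \<sigma> by (auto simp: add_divide_distrib abs_le_iff)
  have "?s \<nu> \<le> stack_inner (psi_sm \<alpha> h A B H l i \<tau>) (fst y) + K * \<bar>\<sigma> - \<tau>\<bar> * z.dual (fst y)"
    unfolding local_sm_def \<sigma>_def[symmetric]
    by (rule z.ip_le_lipschitz[OF lip psi_sm_mem_stack_space \<sigma>(3) \<tau>01])
  moreover have "K * \<bar>\<sigma> - \<tau>\<bar> * z.dual (fst y) \<le> \<bar>K\<bar> * (1 / real Ns) * z.dual (fst y)"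
    using dist z.dual_nonneg by (intro mult_right_mono mult_mono) auto
  moreover have "?n \<nu>' = psi_ns \<alpha> h A B H i \<tau> \<bullet> snd y"
    by (simp add: psi_ns_eq_hat \<tau>_powr local_ns_def \<rho>_def)
  moreover have "stack_inner (psi_sm \<alpha> h A B H l i \<tau>) (fst y) + psi_ns \<alpha> h A B H i \<tau> \<bullet> snd y
      \<le> M_pos \<alpha> h A B H l i y"
    unfolding M_pos_def by (rule cSUP_upper[OF \<tau>01 bdd_above_psi_pos[OF assms(1,3,4) sm ns]])
  moreover have "Lsm_loc r / (8 * real q) * z.dual (fst y) \<le> Lsm / (real Ns)\<^sup>2 / (8 * real q) * z.dual (fst y)"
    using Lsm[OF r(1)] z.dual_nonneg by (intro mult_right_mono divide_right_mono) auto
  moreover have "Lns_loc r / (8 * real q) * u.dual (snd y)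
      \<le> Lns * ((1 / real Ns) powr \<alpha>)\<^sup>2 / (8 * real q) * u.dual (snd y)"
  proof -
    have "0 \<le> Lns"
      by (rule u.smooth_unit_nonneg[OF ns]) simp
    then have "Lns * (grid \<alpha> Ns (Suc r) - grid \<alpha> Ns r)\<^sup>2 \<le> Lns * ((1 / real Ns) powr \<alpha>)\<^sup>2"
      using gap by (intro mult_left_mono power_mono) auto
    then show ?thesis
      using Lns[OF r(1)] u.dual_nonneg by (intro mult_right_mono divide_right_mono) auto
  qed
  ultimately show ?thesis
    unfolding r(2) B_pos_piece_def \<nu>(2) \<nu>'(2) by linarith
qed

lemma tendsto_inverse_powr_zero:
  assumes "0 < \<alpha>"
  shows "(\<lambda>Ns. (1 / real Ns) powr \<alpha>) \<longlonglongrightarrow> 0"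
  using tendsto_powr2[OF lim_1_over_n[where 'a = real] tendsto_const[of \<alpha>]] assms
  by simp

lemma eventually_B_zero_le:
  assumes "norm_on UNIV n0" "1 \<le> q"
    and smooth: "smooth_unit n0 L (psi_zero_hat \<alpha> h A B H i)"
    and L: "\<And>Ns r. 1 \<le> Ns \<Longrightarrow> r < Ns \<Longrightarrow> Lloc Ns r \<le> L / (real Ns)\<^sup>2"
    and less: "M_zero \<alpha> h A B H i y < c"
  shows "\<forall>\<^sub>F Ns in sequentially. B_zero \<alpha> h A B H n0 (Lloc Ns) q Ns i y \<le> c"
proof -
  let ?e = "\<lambda>s. M_zero \<alpha> h A B H i y + L * s\<^sup>2 / (8 * real q) * dual_norm (\<bullet>) UNIV n0 y"
  have "(\<lambda>Ns. ?e (s Ns)) \<longlonglongrightarrow> ?e 0" if "s \<longlonglongrightarrow> 0" for s :: "nat \<Rightarrow> real"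
    using \<open>1 \<le> q\<close> by (intro tendsto_intros that) auto
  from this[OF lim_1_over_n] have "\<forall>\<^sub>F Ns in sequentially.
      M_zero \<alpha> h A B H i y + L * (1 / real Ns)\<^sup>2 / (8 * real q) * dual_norm (\<bullet>) UNIV n0 y < c"
    by (rule order_tendstoD(2)) (simp add: less)
  with eventually_ge_at_top[of 1] show ?thesis
  proof eventually_elim
    case (elim Ns)
    have "B_zero \<alpha> h A B H n0 (Lloc Ns) q Ns i y
        \<le> M_zero \<alpha> h A B H i y + L / (real Ns)\<^sup>2 / (8 * real q) * dual_norm (\<bullet>) UNIV n0 y"
      using L[OF elim(1)] by (rule B_zero_le[OF assms(1) elim(1) \<open>1 \<le> q\<close> smooth])
    with elim(2) show ?case
      by (simp add: power_divide)
  qed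
qed

lemma eventually_B_pos_le:
  assumes "0 < \<alpha>" "\<alpha> \<le> 1" "norm_on (stack_space l) nz" "norm_on UNIV nu" "1 \<le> q"
    and sm: "smooth_unit nz Lsm (psi_sm \<alpha> h A B H l i)"
    and ns: "smooth_unit nu Lns (psi_ns_hat \<alpha> h A B H i)"
    and lip: "lipschitz_unit nz K (psi_sm \<alpha> h A B H l i)"
    and Lsm: "\<And>Ns r. 1 \<le> Ns \<Longrightarrow> r < Ns \<Longrightarrow> Lsm_loc Ns r \<le> Lsm / (real Ns)\<^sup>2"
    and Lns: "\<And>Ns r. 1 \<le> Ns \<Longrightarrow> r < Ns \<Longrightarrow>
                Lns_loc Ns r \<le> Lns * (grid \<alpha> Ns (Suc r) - grid \<alpha> Ns r)\<^sup>2"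
    and less: "M_pos \<alpha> h A B H l i y < c"
  shows "\<forall>\<^sub>F Ns in sequentially. B_pos \<alpha> h A B H nz nu (Lsm_loc Ns) (Lns_loc Ns) q Ns l i y \<le> c"
proof -
  let ?z = "dual_norm stack_inner (stack_space l) nz (fst y)"
  let ?u = "dual_norm (\<bullet>) UNIV nu (snd y)"
  let ?e = "\<lambda>s p. M_pos \<alpha> h A B H l i y + \<bar>K\<bar> * s * ?z + Lsm * s\<^sup>2 / (8 * real q) * ?z
    + Lns * p\<^sup>2 / (8 * real q) * ?u"
  have "(\<lambda>Ns. ?e (s Ns) (p Ns)) \<longlonglongrightarrow> ?e 0 0"
    if "s \<longlonglongrightarrow> 0" "p \<longlonglongrightarrow> 0" for s p :: "nat \<Rightarrow> real"
    using \<open>1 \<le> q\<close> by (intro tendsto_intros that) auto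
  from this[OF lim_1_over_n tendsto_inverse_powr_zero[OF \<open>0 < \<alpha>\<close>]] have "\<forall>\<^sub>F Ns in sequentially. ?e (1 / real Ns) ((1 / real Ns) powr \<alpha>) < c"
    by (rule order_tendstoD(2)) (simp add: less)
  with eventually_ge_at_top[of 1] show ?thesis
  proof eventually_elim
    case (elim Ns)
    have "B_pos \<alpha> h A B H nz nu (Lsm_loc Ns) (Lns_loc Ns) q Ns l i y
      \<le> M_pos \<alpha> h A B H l i y + \<bar>K\<bar> * (1 / real Ns) * ?z
        + Lsm / (real Ns)\<^sup>2 / (8 * real q) * ?z + Lns * ((1 / real Ns) powr \<alpha>)\<^sup>2 / (8 * real q) * ?u"
      using Lsm[OF elim(1)] Lns[OF elim(1)]
      by (rule B_pos_le[OF assms(1-4) elim(1) \<open>1 \<le> q\<close> sm ns lip])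
    with elim(2) show ?case
      by (simp add: power_divide)
  qed
qed

lemma bounded_linear_y_zero: "bounded_linear y_zero"
  unfolding y_zero_def
  by (intro bounded_linear_Pair bounded_linear_fst bounded_linear_lookup_snd)

lemma bounded_linear_y_pos: "bounded_linear (y_pos l)"
  unfolding y_pos_def blocks_def
  by (intro bounded_linear_Pair bounded_linear_fst bounded_linear_lookup_snd bounded_linear_sub
      bounded_linear_sum bounded_linear_compose[OF bounded_linear_single])

section \<open>Convergence of the feasible sets\<close>

theorem theorem2:
  fixes \<alpha> h :: real
    and A :: "real^'n^'n" and B :: "real^'m^'n" and H :: "real^'n^'c" and b :: "real^'c"
    and N q :: nat
    and nz :: "nat \<Rightarrow> ('n, 'm) stack \<Rightarrow> real"
    and nu :: "real^'m \<Rightarrow> real"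
    and n0 :: "(real^'n) \<times> (real^'m) \<Rightarrow> real"
    and Lsm Lns Ksm :: "nat \<Rightarrow> 'c \<Rightarrow> real"
    and L0 :: "'c \<Rightarrow> real"
    and Lsm_loc Lns_loc :: "nat \<Rightarrow> nat \<Rightarrow> 'c \<Rightarrow> nat \<Rightarrow> real"
    and L0_loc :: "nat \<Rightarrow> 'c \<Rightarrow> nat \<Rightarrow> real"
    and w_bar :: "('n, 'm) stack"
  assumes "0 < \<alpha>" and "\<alpha> \<le> 1" and "0 < h"
    and "{x. \<forall>i. (H *v x) $ i \<le> b $ i} \<noteq> {}"
    and "1 \<le> N" and "1 \<le> q"
    and "\<And>l. l \<in> {1..<N} \<Longrightarrow> norm_on (stack_space l) (nz l)"
    and "norm_on UNIV nu"
    and "norm_on UNIV n0"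
    and "\<And>l i. l \<in> {1..<N} \<Longrightarrow> smooth_unit nu (Lns l i) (psi_ns_hat \<alpha> h A B H i)"
    and "\<And>l i. l \<in> {1..<N} \<Longrightarrow> smooth_unit (nz l) (Lsm l i) (psi_sm \<alpha> h A B H l i)"
    and "\<And>l i. l \<in> {1..<N} \<Longrightarrow> lipschitz_unit (nz l) (Ksm l i) (psi_sm \<alpha> h A B H l i)"
    and "\<And>i. smooth_unit n0 (L0 i) (psi_zero_hat \<alpha> h A B H i)"
    and "\<And>Ns l i r. 1 \<le> Ns \<Longrightarrow> l \<in> {1..<N} \<Longrightarrow> r < Ns \<Longrightarrow>
           smooth_unit (nz l) (Lsm_loc Ns l i r) (local_sm \<alpha> h A B H Ns l i r) \<and>
           Lsm_loc Ns l i r \<le> Lsm l i / (real Ns)\<^sup>2"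
    and "\<And>Ns l i r. 1 \<le> Ns \<Longrightarrow> l \<in> {1..<N} \<Longrightarrow> r < Ns \<Longrightarrow>
           smooth_unit nu (Lns_loc Ns l i r) (local_ns \<alpha> h A B H Ns i r) \<and>
           Lns_loc Ns l i r \<le> Lns l i * (grid \<alpha> Ns (Suc r) - grid \<alpha> Ns r)\<^sup>2"
    and "\<And>Ns i r. 1 \<le> Ns \<Longrightarrow> r < Ns \<Longrightarrow>
           smooth_unit n0 (L0_loc Ns i r) (local_zero \<alpha> h A B H Ns i r) \<and>
           L0_loc Ns i r \<le> L0 i / (real Ns)\<^sup>2"
    and "w_bar \<in> stack_space N"
    and "\<And>i. M_zero \<alpha> h A B H i (y_zero w_bar) < b $ i"
    and "\<And>l i. l \<in> {1..<N} \<Longrightarrow> M_pos \<alpha> h A B H l i (y_pos l w_bar) < b $ i"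
  shows "PK_converges
           (\<lambda>Ns. feasible_approx \<alpha> h A B H b N nz nu n0 Lsm_loc Lns_loc L0_loc q Ns)
           (feasible \<alpha> h A B H b N)"
proof -
  have N0: "0 < N"
    using assms(5) by simp
  \<comment> \<open>The index set of the constraints; stage \<open>0\<close> has its own constraint functions, so a pair
    \<open>(0, i)\<close> selects the \<open>zero\<close> variants.\<close>
  define J where "J = {0..<N} \<times> (UNIV :: 'c set)"
  define M where "M = (\<lambda>(l, i) w. if l = 0 then M_zero \<alpha> h A B H i (y_zero w)
    else M_pos \<alpha> h A B H l i (y_pos l w))"
  define U where "U = (\<lambda>Ns (l, i) w.
    if l = 0 then B_zero \<alpha> h A B H n0 (L0_loc Ns i) q Ns i (y_zero w)
    else B_pos \<alpha> h A B H (nz l) nu (Lsm_loc Ns l i) (Lns_loc Ns l i) q Ns l i (y_pos l w))"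
  let ?c = "\<lambda>(l :: nat, i). b $ i"
  have split: "(\<forall>j\<in>J. P j) \<longleftrightarrow> (\<forall>i. P (0, i)) \<and> (\<forall>l\<in>{1..<N}. \<forall>i. P (l, i))" for P
  proof -
    have "{0..<N} = insert 0 {1..<N}"
      using N0 by auto
    then show ?thesis
      by (auto simp: J_def)
  qed
  have index_cases: "thesis" if "j \<in> J" "\<And>i. j = (0, i) \<Longrightarrow> thesis"
      "\<And>l i. j = (l, i) \<Longrightarrow> l \<in> {1..<N} \<Longrightarrow> thesis" for j thesis
    using that(1) that(2)[of "snd j"] that(3)[of "fst j" "snd j"]
    by (cases "fst j = 0") (auto simp: J_def prod_eq_iff)
  have feasible: "feasible \<alpha> h A B H b N = {w \<in> stack_space N. \<forall>j\<in>J. M j w \<le> ?c j}"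
    unfolding split by (simp add: feasible_def M_def)
  have approx: "feasible_approx \<alpha> h A B H b N nz nu n0 Lsm_loc Lns_loc L0_loc q
      = (\<lambda>Ns. {w \<in> stack_space N. \<forall>j\<in>J. U Ns j w \<le> ?c j})"
    unfolding split by (rule ext) (simp add: feasible_approx_def U_def)
  have sup_zero: "convex_on (stack_space N) (M (0, i)) \<and> closed {w. M (0, i) w \<le> x}" for i x
  proof -
    have lin: "bounded_linear (\<lambda>w. psi_zero_hat \<alpha> h A B H i \<rho> \<bullet> y_zero w)" for \<rho>
      by (intro bounded_linear_inner_right_comp bounded_linear_y_zero)
    have bdd: "bdd_above ((\<lambda>\<rho>. psi_zero_hat \<alpha> h A B H i \<rho> \<bullet> y_zero w) ` {0..1})" for w
      by (rule bdd_above_psi_zero_hat[OF assms(9) assms(13)])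
    show ?thesis
      using convex_on_SUP_bounded_linear[OF lin _ bdd subspace_imp_convex[OF subspace_stack_space]]
        closed_SUP_le_bounded_linear[OF lin _ bdd]
      by (simp add: M_def M_zero_def)
  qed
  have sup_pos: "convex_on (stack_space N) (M (l, i)) \<and> closed {w. M (l, i) w \<le> x}"
    if l: "l \<in> {1..<N}" for l i x
  proof -
    have lin: "bounded_linear (\<lambda>w. stack_inner (psi_sm \<alpha> h A B H l i \<tau>) (fst (y_pos l w))
        + psi_ns \<alpha> h A B H i \<tau> \<bullet> snd (y_pos l w))" for \<tau>
      by (intro bounded_linear_add bounded_linear_inner_right_comp
          bounded_linear_compose[OF bounded_linear_stack_inner_right]
          bounded_linear_compose[OF bounded_linear_fst] bounded_linear_compose[OF bounded_linear_snd]
          bounded_linear_y_pos)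
    have bdd: "bdd_above ((\<lambda>\<tau>. stack_inner (psi_sm \<alpha> h A B H l i \<tau>) (fst (y_pos l w))
        + psi_ns \<alpha> h A B H i \<tau> \<bullet> snd (y_pos l w)) ` {0..1})" for w
      by (rule bdd_above_psi_pos[OF assms(1) assms(7)[OF l] assms(8) assms(11)[OF l] assms(10)[OF l]])
    show ?thesis
      using convex_on_SUP_bounded_linear[OF lin _ bdd subspace_imp_convex[OF subspace_stack_space]]
        closed_SUP_le_bounded_linear[OF lin _ bdd] l
      by (simp add: M_def M_pos_def)
  qed
  show ?thesis
    unfolding feasible approx
  proof (rule PK_converges_inner_approximation)
    show "finite J"
      by (simp add: J_def)
    show "convex_on (stack_space N) (M j)" if "j \<in> J" for j
      using that by (rule index_cases) (use sup_zero sup_pos in auto)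
    have "closed {w. M j w \<le> ?c j}" if "j \<in> J" for j
      using that by (rule index_cases) (use sup_zero sup_pos in auto)
    moreover have "{w \<in> stack_space N. \<forall>j\<in>J. M j w \<le> ?c j}
        = stack_space N \<inter> (\<Inter>j\<in>J. {w. M j w \<le> ?c j})"
      by auto
    ultimately show "closed {w \<in> stack_space N. \<forall>j\<in>J. M j w \<le> ?c j}"
      by (simp only:) (intro closed_Int closed_stack_space closed_INT ballI)
    show "M j w \<le> U Ns j w" if Ns: "1 \<le> Ns" and "j \<in> J" for Ns j w
      using that(2)
    proof (rule index_cases)
      fix i assume j: "j = (0, i)"
      show ?thesis
        using M_zero_le_B_zero[OF assms(9) Ns assms(6) conjunct1[OF assms(16)[OF Ns]]]
        by (simp add: j M_def U_def)
    next
      fix l i assume j: "j = (l, i)" and l: "l \<in> {1..<N}"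
      show ?thesis
        using M_pos_le_B_pos[OF assms(1,2) assms(7)[OF l] assms(8) Ns assms(6)
            conjunct1[OF assms(14)[OF Ns l]] conjunct1[OF assms(15)[OF Ns l]]] l
        by (simp add: j M_def U_def)
    qed
    show "\<forall>\<^sub>F Ns in sequentially. U Ns j w \<le> ?c j" if "j \<in> J" and less: "M j w < ?c j" for j w
      using that(1)
    proof (rule index_cases)
      fix i assume j: "j = (0, i)"
      show ?thesis
        using eventually_B_zero_le[OF assms(9,6) assms(13) conjunct2[OF assms(16)]] less
        by (simp add: j M_def U_def)
    next
      fix l i assume j: "j = (l, i)" and l: "l \<in> {1..<N}"
      show ?thesis
        using eventually_B_pos_le[OF assms(1,2) assms(7)[OF l] assms(8,6) assms(11)[OF l]
            assms(10)[OF l] assms(12)[OF l] conjunct2[OF assms(14)[OF _ l]]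
            conjunct2[OF assms(15)[OF _ l]]] less l
        by (simp add: j M_def U_def)
    qed
    show "convex (stack_space N :: ('n, 'm) stack set)"
      by (rule subspace_imp_convex[OF subspace_stack_space])
    show "w_bar \<in> stack_space N"
      by fact
    show "M j w_bar < ?c j" if "j \<in> J" for j
      using that by (rule index_cases) (use assms(18,19) in \<open>auto simp: M_def\<close>)
  qed
qed

end
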